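(* Let $\mathbb{F}$ be an algebraically closed field of characteristic zero. For all integers $n,m,d,k\ge1$ and every nonzero linear map $\phi:\mathrm{Ten}(n,d)\to P(m,k)$ (a $W_k$-rank method, with simples $S$ the rank-one tensors in $\mathrm{Ten}(n,d)$), $$\mathrm{Pot}(\phi)\le 2^{k-1}k^d\cdot n^{\lfloor (k-1)d/k\rfloor}.$$
   Context: $\mathrm{Ten}(n,d)=(\mathbb F^n)^{\otimes d}$; rank-one tensors are those of the form $\mathbf v_1\otimes\cdots\otimes\mathbf v_d$. $P(m,k)$ is the space of homogeneous polynomials of degree $k$ in $m$ variables. The Waring rank $\mathrm{wrk}(f)$ of $f\in P(m,k)$ is the least $r$ such that $f=\sum_{i=1}^r\ell_i^k$ with $\ell_i$ linear forms. For a linear $\phi:V\to P(m,k)$ and spanning set $S\subseteq V$, set $\mu_\phi(v)=\mathrm{wrk}(\phi(v))$, $\mu_\phi(X)=\max_{x\in X}\mu_\phi(x)$, and $\mathrm{Pot}(\phi)=\mu_\phi(V)/\mu_\phi(S)$. *)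

theory Defs
  imports "HOL-Computational_Algebra.Polynomial" "HOL-Library.Poly_Mapping"
    "HOL-Library.Extended_Real"
begin

text \<open>A tensor is represented by its coordinate array: a function from index
  lists (i_1,...,i_d) with each i_j < n to the field, zero outside valid indices.\<close>

definition valid_index :: "nat \<Rightarrow> nat \<Rightarrow> nat list \<Rightarrow> bool" where
  "valid_index n d xs \<longleftrightarrow> length xs = d \<and> set xs \<subseteq> {..<n}"

definition Ten :: "nat \<Rightarrow> nat \<Rightarrow> (nat list \<Rightarrow> 'a::field) set" where
  "Ten n d = {T. \<forall>xs. \<not> valid_index n d xs \<longrightarrow> T xs = 0}"

text \<open>Rank-one tensor v_1 \<otimes> ... \<otimes> v_d, where v j is the vector v_{j+1} in F^n
  (only its coordinates < n matter).\<close>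
definition tensor_prod :: "nat \<Rightarrow> nat \<Rightarrow> (nat \<Rightarrow> nat \<Rightarrow> 'a::field) \<Rightarrow> (nat list \<Rightarrow> 'a)" where
  "tensor_prod n d v = (\<lambda>xs. if valid_index n d xs then (\<Prod>j<d. v j (xs ! j)) else 0)"

definition rank_one_tensors :: "nat \<Rightarrow> nat \<Rightarrow> (nat list \<Rightarrow> 'a::field) set" where
  "rank_one_tensors n d = {tensor_prod n d v | v. True}"

text \<open>Polynomials in variables x_0, x_1, ... are represented as finitely supported
  maps from monomials (exponent vectors) to coefficients.\<close>
type_synonym 'a mpoly = "(nat \<Rightarrow>\<^sub>0 nat) \<Rightarrow>\<^sub>0 'a"

definition mono_degree :: "(nat \<Rightarrow>\<^sub>0 nat) \<Rightarrow> nat" where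
  "mono_degree \<alpha> = (\<Sum>i\<in>Poly_Mapping.keys \<alpha>. Poly_Mapping.lookup \<alpha> i)"

definition P :: "nat \<Rightarrow> nat \<Rightarrow> 'a::field mpoly set" where
  "P m k = {p. \<forall>\<alpha>\<in>Poly_Mapping.keys p. mono_degree \<alpha> = k \<and> Poly_Mapping.keys \<alpha> \<subseteq> {..<m}}"

definition linear_form :: "nat \<Rightarrow> (nat \<Rightarrow> 'a::field) \<Rightarrow> 'a mpoly" where
  "linear_form m c = (\<Sum>i<m. Poly_Mapping.single (Poly_Mapping.single i 1) (c i))"

definition wrk :: "nat \<Rightarrow> nat \<Rightarrow> 'a::field mpoly \<Rightarrow> nat" where
  "wrk m k f = (LEAST r. \<exists>c :: nat \<Rightarrow> nat \<Rightarrow> 'a. f = (\<Sum>i<r. (linear_form m (c i)) ^ k))"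

definition linear_on :: "(nat list \<Rightarrow> 'a::field) set \<Rightarrow> ((nat list \<Rightarrow> 'a) \<Rightarrow> 'a mpoly) \<Rightarrow> bool" where
  "linear_on V phi \<longleftrightarrow> (\<forall>x\<in>V. \<forall>y\<in>V. \<forall>a.
     phi (\<lambda>xs. a * x xs + y xs) = Poly_Mapping.map (\<lambda>t. a * t) (phi x) + phi y)"

definition mu :: "nat \<Rightarrow> nat \<Rightarrow> ('v \<Rightarrow> 'a::field mpoly) \<Rightarrow> 'v set \<Rightarrow> enat" where
  "mu m k phi X = (SUP x\<in>X. enat (wrk m k (phi x)))"

definition Pot :: "nat \<Rightarrow> nat \<Rightarrow> ('v \<Rightarrow> 'a::field mpoly) \<Rightarrow> 'v set \<Rightarrow> 'v set \<Rightarrow> ereal" where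
  "Pot m k phi V S = ereal_of_enat (mu m k phi V) / ereal_of_enat (mu m k phi S)"

end

(* For a generic rank-one tensor with factors v_1, ..., v_d the image under phi is a sum of r
   powers l_i^k, where the coefficients of the l_i are algebraic functions of the coordinates of
   the v_j. Differentiating once with respect to a coordinate x_j of each v_j turns the left side
   into phi(e_{x_1} ... e_{x_d}) and, by the product rule, each l_i^k into a sum of k^d products
   of k linear forms, one for every way of distributing the d derivations over the k factors.
   Some factor receives at least d/k derivations; in phi(T) the summation over their coordinates
   can be absorbed into this factor, which leaves r k^d n^{floor((k-1)d/k)} products, and
   polarization writes each of them as a sum of 2^(k-1) powers.

   In place of algebraic functions serves an ultrapower K of F over the set of all points, for an
   ultrafilter containing the nonvanishing loci of polynomials: a pointwise choice of
   decompositions is a decomposition over K, the partial derivatives extend to derivations of K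
   since the characteristic is zero, and the resulting identity over K holds at some point. *)
theory Submission
  imports Defs "HOL-Library.FuncSet"
begin

section \<open>Extension of derivations\<close>

text \<open>A pair (x, x') stands for the dual number x + \<epsilon> x'; a derivation on a subring is a
  subring of dual numbers which projects injectively to its first component.\<close>

definition dual_subring :: "('k::field_char_0 \<times> 'k) set \<Rightarrow> bool" where
  "dual_subring B \<longleftrightarrow> (1, 0) \<in> B \<and>
     (\<forall>x x' y y'. (x, x') \<in> B \<longrightarrow> (y, y') \<in> B \<longrightarrow>
        (x - y, x' - y') \<in> B \<and> (x * y, x * y' + x' * y) \<in> B)"

definition derivation_graph :: "('k::field_char_0 \<times> 'k) set \<Rightarrow> bool" where
  "derivation_graph B \<longleftrightarrow> dual_subring B \<and> (\<forall>x'. (0, x') \<in> B \<longrightarrow> x' = 0)"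

lemma dual_subring_one: "dual_subring B \<Longrightarrow> (1, 0) \<in> B"
  by (simp add: dual_subring_def)

lemma dual_subring_diff:
  "dual_subring B \<Longrightarrow> (x, x') \<in> B \<Longrightarrow> (y, y') \<in> B \<Longrightarrow> (x - y, x' - y') \<in> B"
  by (simp add: dual_subring_def)

lemma dual_subring_mult:
  "dual_subring B \<Longrightarrow> (x, x') \<in> B \<Longrightarrow> (y, y') \<in> B \<Longrightarrow> (x * y, x * y' + x' * y) \<in> B"
  by (simp add: dual_subring_def)

lemma dual_subring_zero: "dual_subring B \<Longrightarrow> (0, 0) \<in> B"
  using dual_subring_diff[of B 1 0 1 0] dual_subring_one by auto

lemma dual_subring_add:
  assumes "dual_subring B" "(x, x') \<in> B" "(y, y') \<in> B"
  shows "(x + y, x' + y') \<in> B"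
  using dual_subring_diff[OF assms(1,2) dual_subring_diff[OF assms(1) dual_subring_zero[OF assms(1)] assms(3)]]
  by simp

lemma dual_subring_of_nat_mult:
  assumes "dual_subring B" "(x, x') \<in> B"
  shows "(of_nat n * x, of_nat n * x') \<in> B"
proof (induction n)
  case 0
  show ?case using dual_subring_zero[OF assms(1)] by simp
next
  case (Suc n)
  show ?case using dual_subring_add[OF assms Suc] by (simp add: algebra_simps)
qed

lemma dual_subring_sum:
  assumes "dual_subring B" "\<And>i. i \<in> I \<Longrightarrow> (f i, g i) \<in> B"
  shows "(sum f I, sum g I) \<in> B"
  using assms(2)
proof (induction I rule: infinite_finite_induct)
  case (insert a I)
  then show ?case using dual_subring_add[OF assms(1)] by simp
qed (use dual_subring_zero[OF assms(1)] in simp_all)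

text \<open>A pair stands for a polynomial p + \<epsilon> p' over the dual numbers. Over a
  derivation graph, \<open>p'\<close> is \<open>p\<close> with the derivation applied to every
  coefficient.\<close>

definition dual_polys :: "('k::field_char_0 \<times> 'k) set \<Rightarrow> ('k poly \<times> 'k poly) set" where
  "dual_polys B = {(p, p'). \<forall>i. (coeff p i, coeff p' i) \<in> B}"

lemma dual_polys_diff:
  "dual_subring B \<Longrightarrow> (p, p') \<in> dual_polys B \<Longrightarrow> (q, q') \<in> dual_polys B \<Longrightarrow>
     (p - q, p' - q') \<in> dual_polys B"
  by (simp add: dual_polys_def dual_subring_diff)

lemma dual_polys_mult:
  assumes "dual_subring B" "(p, p') \<in> dual_polys B" "(q, q') \<in> dual_polys B"
  shows "(p * q, p * q' + p' * q) \<in> dual_polys B"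
proof -
  have "(\<Sum>i\<le>n. coeff p i * coeff q (n - i),
         \<Sum>i\<le>n. coeff p i * coeff q' (n - i) + coeff p' i * coeff q (n - i)) \<in> B" for n
    using assms by (intro dual_subring_sum dual_subring_mult) (auto simp: dual_polys_def)
  then show ?thesis
    by (simp add: dual_polys_def coeff_mult sum.distrib)
qed

lemma dual_polys_monom:
  "dual_subring B \<Longrightarrow> (c, c') \<in> B \<Longrightarrow> (monom c n, monom c' n) \<in> dual_polys B"
  by (auto simp: dual_polys_def dual_subring_zero)

text \<open>Differentiating only introduces natural factors, which a derivation treats as constants.
  This lets the derivative of a vanishing polynomial of least degree compete for the
  minimum.\<close>

lemma dual_polys_pderiv:
  "dual_subring B \<Longrightarrow> (p, p') \<in> dual_polys B \<Longrightarrow> (pderiv p, pderiv p') \<in> dual_polys B"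
  using dual_subring_of_nat_mult[of B] by (auto simp: dual_polys_def coeff_pderiv simp del: of_nat_Suc)

text \<open>The second component of the value of the dual polynomial p + \<epsilon> p' at t + \<epsilon> b.\<close>
definition dual_eval :: "'k::field_char_0 \<Rightarrow> 'k \<Rightarrow> 'k poly \<Rightarrow> 'k poly \<Rightarrow> 'k" where
  "dual_eval t b p p' = poly p' t + b * poly (pderiv p) t"

lemma dual_eval_mult:
  "dual_eval t b (p * q) (p * q' + p' * q) = poly p t * dual_eval t b q q' + dual_eval t b p p' * poly q t"
  by (simp add: dual_eval_def pderiv_mult algebra_simps)

lemma dual_eval_diff:
  "dual_eval t b (p - q) (p' - q') = dual_eval t b p p' - dual_eval t b q q'"
  by (simp add: dual_eval_def pderiv_diff algebra_simps)

text \<open>If t is algebraic, b is the value forced by a vanishing polynomial of least degree;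
  pseudo-division shows that it is consistent with all other vanishing polynomials.\<close>
lemma dual_eval_choice:
  assumes B: "derivation_graph B"
  shows "\<exists>b. \<forall>p p'. (p, p') \<in> dual_polys B \<longrightarrow> poly p t = 0 \<longrightarrow> dual_eval t b p p' = 0"
proof (cases "\<exists>q q'. (q, q') \<in> dual_polys B \<and> q \<noteq> 0 \<and> poly q t = 0")
  case False
  \<comment> \<open>Here t is transcendental over the given subring, so any b would do; 0 is
    taken.\<close>
  have "dual_eval t 0 p p' = 0" if "(p, p') \<in> dual_polys B" "poly p t = 0" for p p'
  proof -
    have "p = 0" using False that by blast
    then have "p' = 0"
      using that(1) B by (auto simp: dual_polys_def derivation_graph_def poly_eq_iff)
    with \<open>p = 0\<close> show ?thesis by (simp add: dual_eval_def)
  qed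
  then show ?thesis by blast
next
  case True
  have sub: "dual_subring B" using B by (simp add: derivation_graph_def)
  let ?V = "\<lambda>q q'. (q, q') \<in> dual_polys B \<and> q \<noteq> 0 \<and> poly q t = 0"
  define N where "N = (LEAST n. \<exists>q q'. ?V q q' \<and> degree q = n)"
  obtain q q' where q: "(q, q') \<in> dual_polys B" "q \<noteq> 0" "poly q t = 0" "degree q = N"
    unfolding N_def using LeastI_ex[of "\<lambda>n. \<exists>q q'. ?V q q' \<and> degree q = n"] True by blast
  have min: "N \<le> degree p" if "?V p p'" for p p'
    unfolding N_def by (rule Least_le) (use that in blast)
  have "N > 0"
  proof (rule ccontr)
    assume "\<not> N > 0"
    then obtain a where "q = [:a:]" using q(4) by (auto elim: degree_eq_zeroE)
    with q show False by simp
  qed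
  \<comment> \<open>Separability: in characteristic zero the derivative is nonzero of degree N - 1,
    so vanishing at t would contradict minimality.\<close>
  have "poly (pderiv q) t \<noteq> 0"
  proof
    assume "poly (pderiv q) t = 0"
    moreover have "pderiv q \<noteq> 0" using \<open>N > 0\<close> q(4) by (simp add: pderiv_eq_0_iff)
    ultimately have "N \<le> degree (pderiv q)"
      using min dual_polys_pderiv[OF sub q(1)] by blast
    then show False using \<open>N > 0\<close> q(4) by (simp add: degree_pderiv)
  qed
  \<comment> \<open>The solution of the linear equation
    \<open>dual_eval t b q q' = 0\<close>.\<close>
  define b where "b = - poly q' t / poly (pderiv q) t"
  have evq: "dual_eval t b q q' = 0"
    using \<open>poly (pderiv q) t \<noteq> 0\<close> by (simp add: dual_eval_def b_def)
  have "dual_eval t b p p' = 0" if "(p, p') \<in> dual_polys B" "poly p t = 0" for p p'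
    using that
  proof (induction "degree p" arbitrary: p p' rule: less_induct)
    case less
    show ?case
    proof (cases "p = 0")
      case True
      then have "p' = 0"
        using less.prems(1) B by (auto simp: dual_polys_def derivation_graph_def poly_eq_iff)
      with True show ?thesis by (simp add: dual_eval_def)
    next
      case False
      then have le: "N \<le> degree p" using min less.prems by blast
      define s where "s = degree p - N"
      define c where "c = coeff q N"
      define c' where "c' = coeff q' N"
      define e where "e = coeff p (degree p)"
      define e' where "e' = coeff p' (degree p)"
      note ce = c_def c'_def e_def e'_def
      have c: "(monom c 0, monom c' 0) \<in> dual_polys B" and e: "(monom e s, monom e' s) \<in> dual_polys B"
        using q(1) less.prems(1) dual_polys_monom[OF sub] by (auto simp: ce dual_polys_def)
      \<comment> \<open>Pseudo-remainder: coefficients lie in a ring only, so p is multiplied by the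
        leading coefficient c of q instead of dividing by it. The pair \<open>(w, w')\<close> is the
        same combination computed with dual polynomials.\<close>
      define w where "w = monom c 0 * p - monom e s * q"
      define w' where "w' = (monom c 0 * p' + monom c' 0 * p) - (monom e s * q' + monom e' s * q)"
      have mem: "(w, w') \<in> dual_polys B"
        unfolding w_def w'_def by (intro dual_polys_diff dual_polys_mult sub c e q less.prems)
      have "c \<noteq> 0" using q by (auto simp: ce)
      have "degree w < degree p"
      proof -
        have d1: "degree (monom c 0 * p) \<le> degree p"
          using degree_mult_le[of "monom c 0" p] by (simp add: degree_monom_eq \<open>c \<noteq> 0\<close>)
        have d2: "degree (monom e s * q) \<le> degree p"
          using degree_mult_le[of "monom e s" q] degree_monom_le[of e s] le q(4) by (simp add: s_def)
        have "coeff w (degree p) = 0"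
          using le by (simp add: w_def w'_def coeff_monom_mult ce s_def)
        moreover have "degree w \<le> degree p"
          unfolding w_def w'_def by (intro degree_diff_le d1 d2)
        \<comment> \<open>Needed for a strict drop, since the zero polynomial also has degree
          0.\<close>
        moreover have "degree p > 0" using le \<open>N > 0\<close> by simp
        ultimately show ?thesis
          by (metis degree_0 leading_coeff_0_iff le_neq_implies_less)
      qed
      moreover have "poly w t = 0" using q less.prems by (simp add: w_def w'_def)
      ultimately have "dual_eval t b w w' = 0" using less.hyps mem by blast
      \<comment> \<open>By the product rule every other term contains \<open>poly p t\<close>,
        \<open>poly q t\<close> or \<open>dual_eval t b q q'\<close>, all of them zero.\<close>
      then have "c * dual_eval t b p p' = 0"
        unfolding w_def w'_def dual_eval_diff dual_eval_mult
        using evq q(3) less.prems(2) by (simp add: poly_monom)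
      then show ?thesis using \<open>c \<noteq> 0\<close> by simp
    qed
  qed
  then show ?thesis by blast
qed

text \<open>Adjoins one element: the values at t + \<epsilon> b of all dual polynomials over B form
  a dual subring. It still projects injectively because b was chosen so that a vanishing first
  component forces a vanishing second one.\<close>

lemma derivation_graph_extend:
  assumes B: "derivation_graph B"
  shows "\<exists>C b. derivation_graph C \<and> B \<subseteq> C \<and> (t, b) \<in> C"
proof -
  have sub: "dual_subring B" using B by (simp add: derivation_graph_def)
  obtain b where b: "\<And>p p'. (p, p') \<in> dual_polys B \<Longrightarrow> poly p t = 0 \<Longrightarrow> dual_eval t b p p' = 0"
    using dual_eval_choice[OF B] by blast
  define C where "C = {(poly p t, dual_eval t b p p') | p p'. (p, p') \<in> dual_polys B}"
  have memI: "(x, x') \<in> C" if "(p, p') \<in> dual_polys B" "x = poly p t" "x' = dual_eval t b p p'" for p p' x x'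
    using that C_def by blast
  have const: "B \<subseteq> C"
    using memI[OF dual_polys_monom[OF sub, of _ _ 0]]
    by (force simp: dual_eval_def poly_monom monom_0)
  have "(x - y, x' - y') \<in> C \<and> (x * y, x * y' + x' * y) \<in> C"
    if xy: "(x, x') \<in> C" "(y, y') \<in> C" for x x' y y'
  proof -
    obtain p p' where p: "(p, p') \<in> dual_polys B" "x = poly p t" "x' = dual_eval t b p p'"
      using xy(1) unfolding C_def by auto
    obtain q q' where q: "(q, q') \<in> dual_polys B" "y = poly q t" "y' = dual_eval t b q q'"
      using xy(2) unfolding C_def by auto
    show ?thesis
      using memI[OF dual_polys_diff[OF sub p(1) q(1)]] memI[OF dual_polys_mult[OF sub p(1) q(1)]]
      by (simp add: p q dual_eval_diff dual_eval_mult)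
  qed
  then have "dual_subring C"
    unfolding dual_subring_def using const dual_subring_one[OF sub] by blast
  moreover have "x' = 0" if "(0, x') \<in> C" for x'
  proof -
    obtain p p' where "(p, p') \<in> dual_polys B" "0 = poly p t" "x' = dual_eval t b p p'"
      using \<open>(0, x') \<in> C\<close> unfolding C_def by auto
    then show ?thesis using b[of p p'] by simp
  qed
  moreover have "(t, b) \<in> C"
    by (rule memI[OF dual_polys_monom[OF sub dual_subring_one[OF sub], of 1]])
      (simp_all add: dual_eval_def poly_monom pderiv_monom)
  ultimately show ?thesis using const unfolding derivation_graph_def by blast
qed

text \<open>Zorn's lemma: unions of chains of derivation graphs are derivation graphs, and a maximal
  one is the graph of a function on the whole field, as any missing element could be
  adjoined.\<close>

lemma derivation_extends:
  fixes B :: "('k::field_char_0 \<times> 'k) set"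
  assumes B: "derivation_graph B"
  shows "\<exists>D. (\<forall>x y. D (x + y) = D x + D y) \<and> (\<forall>x y. D (x * y) = x * D y + D x * y) \<and>
           (\<forall>(x, x') \<in> B. D x = x')"
proof -
  let ?A = "{C. derivation_graph C \<and> B \<subseteq> C}"
  have "\<Union>\<C> \<in> ?A" if ne: "\<C> \<noteq> {}" and ch: "subset.chain ?A \<C>" for \<C>
  proof -
    have mem: "derivation_graph C" "B \<subseteq> C" if "C \<in> \<C>" for C
      using ch that unfolding subset.chain_def by blast+
    have two: "\<exists>C\<in>\<C>. p \<in> C \<and> q \<in> C" if pq: "p \<in> \<Union>\<C>" "q \<in> \<Union>\<C>" for p q
    proof -
      obtain C1 C2 where "C1 \<in> \<C>" "C2 \<in> \<C>" "p \<in> C1" "q \<in> C2" using pq by blast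
      moreover from this have "C1 \<subseteq> C2 \<or> C2 \<subseteq> C1" using ch unfolding subset.chain_def by blast
      ultimately show ?thesis by blast
    qed
    have "dual_subring (\<Union>\<C>)"
      unfolding dual_subring_def
    proof (intro conjI allI impI)
      show "(1, 0) \<in> \<Union>\<C>"
        using ne mem unfolding derivation_graph_def by (blast intro: dual_subring_one)
    next
      fix x x' y y' assume "(x, x') \<in> \<Union>\<C>" "(y, y') \<in> \<Union>\<C>"
      then obtain C where C: "C \<in> \<C>" "(x, x') \<in> C" "(y, y') \<in> C" using two by blast
      then have "dual_subring C" using mem by (auto simp: derivation_graph_def)
      then show "(x - y, x' - y') \<in> \<Union>\<C>" "(x * y, x * y' + x' * y) \<in> \<Union>\<C>"
        using C dual_subring_diff dual_subring_mult by blast+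
    qed
    moreover have "x' = 0" if "(0, x') \<in> \<Union>\<C>" for x'
      using that mem(1) unfolding derivation_graph_def by blast
    moreover have "B \<subseteq> \<Union>\<C>" using ne mem(2) by blast
    ultimately show ?thesis by (simp add: derivation_graph_def)
  qed
  moreover have "?A \<noteq> {}" using B by blast
  ultimately obtain M where M: "derivation_graph M" "B \<subseteq> M"
    and max: "\<And>C. derivation_graph C \<Longrightarrow> B \<subseteq> C \<Longrightarrow> M \<subseteq> C \<Longrightarrow> C = M"
    using subset_Zorn_nonempty[of ?A] by (smt (verit) mem_Collect_eq)
  have total: "\<exists>b. (t, b) \<in> M" for t
    using derivation_graph_extend[OF M(1), of t] max M(2) by (metis subset_trans)
  have sub: "dual_subring M" using M by (simp add: derivation_graph_def)
  have uniq: "b = c" if "(t, b) \<in> M" "(t, c) \<in> M" for t b c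
    using dual_subring_diff[OF sub that] M(1) by (auto simp: derivation_graph_def)
  define D where "D t = (SOME b. (t, b) \<in> M)" for t
  have D: "(t, D t) \<in> M" for t unfolding D_def using someI_ex[OF total] .
  show ?thesis
  proof (intro exI[of _ D] conjI allI)
    show "D (x + y) = D x + D y" for x y
      by (rule uniq[OF D dual_subring_add[OF sub D D]])
    show "D (x * y) = x * D y + D x * y" for x y
      by (rule uniq[OF D dual_subring_mult[OF sub D D]])
    show "\<forall>(x, x') \<in> B. D x = x'"
      using uniq[OF D] M(2) by blast
  qed
qed

section \<open>A generic ultrapower\<close>

inductive poly_fun :: "(('i \<Rightarrow> 'a::field_char_0) \<Rightarrow> 'a) \<Rightarrow> bool" where
  poly_fun_const: "poly_fun (\<lambda>_. c)"
| poly_fun_var: "poly_fun (\<lambda>x. x i)"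
| poly_fun_diff: "poly_fun f \<Longrightarrow> poly_fun g \<Longrightarrow> poly_fun (\<lambda>x. f x - g x)"
| poly_fun_mult: "poly_fun f \<Longrightarrow> poly_fun g \<Longrightarrow> poly_fun (\<lambda>x. f x * g x)"

text \<open>A relation, because one function can be built in several ways; that the derivative
  depends on the function alone is extracted from \<open>partial_deriv_zero\<close>.\<close>

inductive partial_deriv :: "'i \<Rightarrow> (('i \<Rightarrow> 'a::field_char_0) \<Rightarrow> 'a) \<Rightarrow> (('i \<Rightarrow> 'a) \<Rightarrow> 'a) \<Rightarrow> bool"
  for i where
  partial_deriv_const: "partial_deriv i (\<lambda>_. c) (\<lambda>_. 0)"
| partial_deriv_var: "partial_deriv i (\<lambda>x. x j) (\<lambda>_. if j = i then 1 else 0)"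
| partial_deriv_diff: "partial_deriv i f f' \<Longrightarrow> partial_deriv i g g' \<Longrightarrow>
    partial_deriv i (\<lambda>x. f x - g x) (\<lambda>x. f' x - g' x)"
| partial_deriv_mult: "partial_deriv i f f' \<Longrightarrow> partial_deriv i g g' \<Longrightarrow>
    partial_deriv i (\<lambda>x. f x * g x) (\<lambda>x. f x * g' x + f' x * g x)"

lemma poly_fun_if_partial_deriv: "partial_deriv i f f' \<Longrightarrow> poly_fun f"
  by (induction rule: partial_deriv.induct) (auto intro: poly_fun.intros)

lemma poly_fun_on_line:
  assumes "poly_fun f"
  shows "\<exists>p. \<forall>t. f (\<lambda>i. x i + t * (y i - x i)) = poly p t"
  using assms
proof induction
  case (poly_fun_const c)
  then show ?case by (intro exI[of _ "[:c:]"]) simp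
next
  case (poly_fun_var i)
  then show ?case by (intro exI[of _ "[:x i, y i - x i:]"]) simp
next
  case (poly_fun_diff f g)
  then obtain p q where "\<forall>t. f (\<lambda>i. x i + t * (y i - x i)) = poly p t"
    "\<forall>t. g (\<lambda>i. x i + t * (y i - x i)) = poly q t" by blast
  then show ?case by (intro exI[of _ "p - q"]) simp
next
  case (poly_fun_mult f g)
  then obtain p q where "\<forall>t. f (\<lambda>i. x i + t * (y i - x i)) = poly p t"
    "\<forall>t. g (\<lambda>i. x i + t * (y i - x i)) = poly q t" by blast
  then show ?case by (intro exI[of _ "p * q"]) simp
qed

text \<open>Restriction to the line through x in direction i reduces the formal derivative to that
  of a polynomial in one variable, which is determined by its values.\<close>

lemma partial_deriv_as_pderiv:
  assumes "partial_deriv i f f'"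
  shows "\<exists>p. (\<forall>t. f (x(i := x i + t)) = poly p t) \<and> f' x = poly (pderiv p) 0"
  using assms
proof induction
  case (partial_deriv_const c)
  then show ?case by (intro exI[of _ "[:c:]"]) simp
next
  case (partial_deriv_var j)
  then show ?case
    by (intro exI[of _ "[:x j, if j = i then 1 else 0:]"]) (simp add: pderiv_pCons)
next
  case (partial_deriv_diff f f' g g')
  then obtain p q where "\<forall>t. f (x(i := x i + t)) = poly p t" "f' x = poly (pderiv p) 0"
    "\<forall>t. g (x(i := x i + t)) = poly q t" "g' x = poly (pderiv q) 0" by blast
  then show ?case by (intro exI[of _ "p - q"]) (simp add: pderiv_diff fun_upd_def)
next
  case (partial_deriv_mult f f' g g')
  then obtain p q where *: "\<forall>t. f (x(i := x i + t)) = poly p t" "f' x = poly (pderiv p) 0"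
    "\<forall>t. g (x(i := x i + t)) = poly q t" "g' x = poly (pderiv q) 0" by blast
  then have "f x = poly p 0" "g x = poly q 0"
    by (metis add.right_neutral fun_upd_triv)+
  with * show ?case by (intro exI[of _ "p * q"]) (simp add: pderiv_mult algebra_simps fun_upd_def)
qed

lemma partial_deriv_zero:
  assumes "partial_deriv i (\<lambda>_. 0) f'"
  shows "f' = (\<lambda>_. 0)"
proof
  fix x
  obtain p where "\<forall>t. 0 = poly p t" "f' x = poly (pderiv p) 0"
    using partial_deriv_as_pderiv[OF assms] by blast
  moreover from this have "p = 0" by (metis poly_0 poly_eq_poly_eq_iff ext)
  ultimately show "f' x = 0" by simp
qed

text \<open>On the line joining x to y both functions become nonzero polynomials in one variable,
  and their nonzero product does not vanish everywhere on an infinite field. So nonvanishing loci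
  meet.\<close>

lemma poly_fun_mult_nonzero:
  assumes f: "poly_fun f" "f x \<noteq> 0" and g: "poly_fun g" "g y \<noteq> 0"
  shows "\<exists>z. f z * g z \<noteq> 0"
proof -
  obtain p where p: "\<And>t. f (\<lambda>i. x i + t * (y i - x i)) = poly p t"
    using poly_fun_on_line[OF f(1)] by blast
  obtain q where q: "\<And>t. g (\<lambda>i. x i + t * (y i - x i)) = poly q t"
    using poly_fun_on_line[OF g(1)] by blast
  have "p \<noteq> 0" using p[of 0] f(2) by auto
  moreover have "q \<noteq> 0" using q[of 1] g(2) by auto
  ultimately have "p * q \<noteq> 0" by simp
  then obtain t where "poly (p * q) t \<noteq> 0" by (metis poly_0 poly_eq_poly_eq_iff ext)
  then show ?thesis using p[of t] q[of t] by (metis poly_mult)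
qed

section \<open>Ultrafilters and the notion of a generic point\<close>

definition set_ultrafilter :: "'i set set \<Rightarrow> bool" where
  "set_ultrafilter U \<longleftrightarrow> {} \<notin> U \<and> (\<forall>S\<in>U. \<forall>T\<in>U. S \<inter> T \<in> U) \<and>
     (\<forall>S\<in>U. \<forall>T. S \<subseteq> T \<longrightarrow> T \<in> U) \<and> (\<forall>S. S \<in> U \<or> - S \<in> U)"

text \<open>By Zorn's lemma there is a maximal proper filter above the filter base G, and maximality
  forces it to decide every set.\<close>

lemma set_ultrafilter_exists:
  assumes ne: "G \<noteq> {}" and empty: "{} \<notin> G" and inter: "\<And>S T. S \<in> G \<Longrightarrow> T \<in> G \<Longrightarrow> S \<inter> T \<in> G"
  shows "\<exists>U. set_ultrafilter U \<and> G \<subseteq> U"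
proof -
  define flt :: "'a set set \<Rightarrow> bool" where
    "flt U \<longleftrightarrow> G \<subseteq> U \<and> {} \<notin> U \<and> (\<forall>S\<in>U. \<forall>T\<in>U. S \<inter> T \<in> U) \<and> (\<forall>S\<in>U. \<forall>T. S \<subseteq> T \<longrightarrow> T \<in> U)"
    for U
  have "flt {T. \<exists>S\<in>G. S \<subseteq> T}"
    unfolding flt_def
  proof (intro conjI ballI allI impI)
    show "G \<subseteq> {T. \<exists>S\<in>G. S \<subseteq> T}" "{} \<notin> {T. \<exists>S\<in>G. S \<subseteq> T}"
      using empty by auto
    fix S T assume "S \<in> {T. \<exists>S\<in>G. S \<subseteq> T}" "T \<in> {T. \<exists>S\<in>G. S \<subseteq> T}"
    then obtain S' T' where "S' \<in> G" "T' \<in> G" "S' \<subseteq> S" "T' \<subseteq> T" by blast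
    moreover from this have "S' \<inter> T' \<in> G" using inter by blast
    ultimately show "S \<inter> T \<in> {T. \<exists>S\<in>G. S \<subseteq> T}"
      by (intro CollectI bexI[of _ "S' \<inter> T'"]) auto
  next
    fix S T assume "S \<in> {T. \<exists>S\<in>G. S \<subseteq> T}" "S \<subseteq> T"
    then show "T \<in> {T. \<exists>S\<in>G. S \<subseteq> T}" by auto
  qed
  moreover have "flt (\<Union>\<C>)" if ne: "\<C> \<noteq> {}" and ch: "subset.chain {U. flt U} \<C>" for \<C>
  proof -
    have mem: "flt U" if "U \<in> \<C>" for U
      using ch that unfolding subset.chain_def by auto
    show ?thesis
      unfolding flt_def
    proof (intro conjI ballI allI impI)
      obtain U where "U \<in> \<C>" using ne by blast
      then show "G \<subseteq> \<Union>\<C>" using mem[of U] unfolding flt_def by (meson Union_upper order_trans)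
      show "{} \<notin> \<Union>\<C>" using mem unfolding flt_def by auto
    next
      fix S T assume "S \<in> \<Union>\<C>" "T \<in> \<Union>\<C>"
      then obtain U1 U2 where U12: "U1 \<in> \<C>" "U2 \<in> \<C>" "S \<in> U1" "T \<in> U2" by auto
      then have "U1 \<subseteq> U2 \<or> U2 \<subseteq> U1" using ch unfolding subset.chain_def by auto
      then obtain U where U: "U \<in> \<C>" "S \<in> U" "T \<in> U" using U12 by auto
      then have "S \<inter> T \<in> U" using mem[of U] unfolding flt_def by simp
      then show "S \<inter> T \<in> \<Union>\<C>" using U(1) by auto
    next
      fix S T assume "S \<in> \<Union>\<C>" "S \<subseteq> T"
      then obtain U where U: "U \<in> \<C>" "S \<in> U" by auto
      then have "T \<in> U" using mem[of U] \<open>S \<subseteq> T\<close> unfolding flt_def by auto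
      then show "T \<in> \<Union>\<C>" using U(1) by auto
    qed
  qed
  ultimately obtain U where U: "flt U" and max: "\<And>V. flt V \<Longrightarrow> U \<subseteq> V \<Longrightarrow> V = U"
    using subset_Zorn_nonempty[of "{U. flt U}"] by (smt (verit) mem_Collect_eq empty_iff)
  have sup: "G \<subseteq> U" and proper: "{} \<notin> U" and cap: "\<And>S T. S \<in> U \<Longrightarrow> T \<in> U \<Longrightarrow> S \<inter> T \<in> U"
    and up: "\<And>S T. S \<in> U \<Longrightarrow> S \<subseteq> T \<Longrightarrow> T \<in> U"
    using U unfolding flt_def by auto
  have "S \<in> U \<or> - S \<in> U" for S
  proof (rule ccontr)
    assume neither: "\<not> (S \<in> U \<or> - S \<in> U)"
    \<comment> \<open>The filter generated by U and S. It is proper, since a member of U disjoint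
      from S would put the complement of S into U.\<close>
    define V where "V = {T. \<exists>R\<in>U. R \<inter> S \<subseteq> T}"
    have memV: "T \<in> V \<longleftrightarrow> (\<exists>R\<in>U. R \<inter> S \<subseteq> T)" for T by (simp add: V_def)
    have sub: "U \<subseteq> V" using memV by (auto intro!: bexI)
    have "flt V"
      unfolding flt_def
    proof (intro conjI ballI allI impI)
      show "G \<subseteq> V" using sup sub by (rule order_trans)
      show "{} \<notin> V"
      proof
        assume "{} \<in> V"
        then obtain R where "R \<in> U" "R \<inter> S \<subseteq> {}" unfolding memV by (elim bexE)
        then have "- S \<in> U" using up[of R "- S"] by auto
        then show False using neither by simp
      qed
    next
      fix T1 T2 assume "T1 \<in> V" "T2 \<in> V"
      then obtain R1 R2 where R: "R1 \<in> U" "R2 \<in> U" "R1 \<inter> S \<subseteq> T1" "R2 \<inter> S \<subseteq> T2"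
        unfolding memV by (elim bexE)
      show "T1 \<inter> T2 \<in> V"
        unfolding memV using R by (intro bexI[of _ "R1 \<inter> R2"] cap) auto
    next
      fix T T' assume "T \<in> V" "T \<subseteq> T'"
      then show "T' \<in> V" unfolding memV by (meson order_trans)
    qed
    then have "V = U" using max sub by simp
    moreover obtain R where "R \<in> U" using sup ne by auto
    then have "S \<in> V" unfolding memV by (intro bexI[of _ R]) simp_all
    ultimately show False using neither by simp
  qed
  then have "set_ultrafilter U"
    unfolding set_ultrafilter_def using proper cap up by simp
  with sup show ?thesis by auto
qed

text \<open>The nonempty principal open sets of the Zariski topology.\<close>

definition nonvanishing_sets :: "('i \<Rightarrow> 'a::field_char_0) set set" where
  "nonvanishing_sets = {{x. f x \<noteq> 0} | f. poly_fun f \<and> (\<exists>x. f x \<noteq> 0)}"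

lemma nonvanishing_setsI:
  assumes "poly_fun f" "f x \<noteq> 0"
  shows "{x. f x \<noteq> 0} \<in> nonvanishing_sets"
  unfolding nonvanishing_sets_def mem_Collect_eq by (rule exI[of _ f]) (use assms in auto)

lemma nonvanishing_setsE:
  assumes "S \<in> nonvanishing_sets"
  obtains f x where "poly_fun f" "S = {x. f x \<noteq> 0}" "f x \<noteq> 0"
  using assms unfolding nonvanishing_sets_def mem_Collect_eq by (elim exE conjE)

definition generic_ultrafilter :: "('i \<Rightarrow> 'a::field_char_0) set set" where
  "generic_ultrafilter = (SOME U. set_ultrafilter U \<and> nonvanishing_sets \<subseteq> U)"

lemma generic_ultrafilter:
  "set_ultrafilter (generic_ultrafilter :: ('i \<Rightarrow> 'a::field_char_0) set set) \<and>
   nonvanishing_sets \<subseteq> (generic_ultrafilter :: ('i \<Rightarrow> 'a) set set)"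
proof -
  let ?G = "nonvanishing_sets :: ('i \<Rightarrow> 'a) set set"
  have "{x. (1::'a) \<noteq> 0} \<in> ?G"
    by (rule nonvanishing_setsI[where f = "\<lambda>_. 1"]) (simp_all add: poly_fun_const)
  then have "?G \<noteq> {}" by auto
  moreover have "{} \<notin> ?G" by (auto elim!: nonvanishing_setsE)
  moreover have "S \<inter> T \<in> ?G" if S: "S \<in> ?G" and T: "T \<in> ?G" for S T
  proof -
    obtain f x where f: "poly_fun f" "S = {x. f x \<noteq> 0}" "f x \<noteq> 0"
      using S by (rule nonvanishing_setsE)
    obtain g y where g: "poly_fun g" "T = {x. g x \<noteq> 0}" "g y \<noteq> 0"
      using T by (rule nonvanishing_setsE)
    obtain z where "f z * g z \<noteq> 0"
      using poly_fun_mult_nonzero[OF f(1,3) g(1,3)] by (elim exE)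
    with poly_fun_mult[OF f(1) g(1)] have "{x. f x * g x \<noteq> 0} \<in> ?G"
      by (rule nonvanishing_setsI[where f = "\<lambda>x. f x * g x"])
    moreover have "S \<inter> T = {x. f x * g x \<noteq> 0}" using f(2) g(2) by auto
    ultimately show ?thesis by simp
  qed
  ultimately have "\<exists>U. set_ultrafilter U \<and> ?G \<subseteq> U" by (rule set_ultrafilter_exists)
  then show ?thesis unfolding generic_ultrafilter_def by (rule someI_ex)
qed

definition generically :: "(('i \<Rightarrow> 'a::field_char_0) \<Rightarrow> bool) \<Rightarrow> bool" where
  "generically Q \<longleftrightarrow> {x. Q x} \<in> generic_ultrafilter"

lemma generically_mono: "generically Q \<Longrightarrow> (\<And>x. Q x \<Longrightarrow> R x) \<Longrightarrow> generically R"
  using generic_ultrafilter unfolding generically_def set_ultrafilter_def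
  by (metis (mono_tags, lifting) Collect_mono)

lemma generically_conj: "generically Q \<Longrightarrow> generically R \<Longrightarrow> generically (\<lambda>x. Q x \<and> R x)"
  using generic_ultrafilter unfolding generically_def set_ultrafilter_def
  by (metis (mono_tags, lifting) Collect_conj_eq)

lemma generically_conj_mono:
  "generically Q \<Longrightarrow> generically R \<Longrightarrow> (\<And>x. Q x \<Longrightarrow> R x \<Longrightarrow> T x) \<Longrightarrow> generically T"
  using generically_mono[OF generically_conj] by blast

lemma generically_not: "generically Q \<or> generically (\<lambda>x. \<not> Q x)"
proof -
  have "{x. \<not> Q x} = - {x. Q x}" by auto
  then show ?thesis using generic_ultrafilter unfolding generically_def set_ultrafilter_def by metis
qed

lemma generically_False [simp]: "\<not> generically (\<lambda>x. False)"
  using generic_ultrafilter unfolding generically_def set_ultrafilter_def Collect_empty_eq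
  by (metis empty_def)

lemma generically_ex: "generically Q \<Longrightarrow> \<exists>x. Q x"
  using generically_mono[of Q "\<lambda>_. False"] generically_False by blast

lemma generically_True [simp]: "generically (\<lambda>x. True)"
  using generically_not[of "\<lambda>x. True"] by simp

lemma generically_ball_finite:
  assumes "finite S" "\<And>s. s \<in> S \<Longrightarrow> generically (Q s)"
  shows "generically (\<lambda>x. \<forall>s\<in>S. Q s x)"
  using assms
proof (induction S)
  case empty
  then show ?case by simp
next
  case (insert s S)
  then show ?case using generically_conj[of "Q s"] by simp
qed

text \<open>Otherwise the nonvanishing locus belongs to the ultrafilter together with its
  complement. In consequence polynomial functions embed into the ultrapower.\<close>

lemma poly_fun_generically_zero:
  assumes "poly_fun f" "generically (\<lambda>x. f x = 0)"
  shows "f = (\<lambda>_. 0)"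
proof (rule ccontr)
  assume "f \<noteq> (\<lambda>_. 0)"
  then obtain x where "f x \<noteq> 0" by (auto simp: fun_eq_iff)
  from nonvanishing_setsI[where f = f, OF assms(1) this]
  have "generically (\<lambda>x. f x \<noteq> 0)"
    unfolding generically_def by (rule subsetD[OF conjunct2[OF generic_ultrafilter]])
  then show False using generically_conj_mono[OF assms(2)] generically_ex by blast
qed

\<comment> \<open>The ultrapower as a field of characteristic zero\<close>
quotient_type (overloaded) ('i, 'a) generic_power =
  "('i \<Rightarrow> 'a::field_char_0) \<Rightarrow> 'a" / "\<lambda>f g. generically (\<lambda>x. f x = g x)"
proof (rule equivpI)
  show "reflp (\<lambda>f g :: ('i \<Rightarrow> 'a) \<Rightarrow> 'a. generically (\<lambda>x. f x = g x))"
    by (rule reflpI) simp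
  show "symp (\<lambda>f g :: ('i \<Rightarrow> 'a) \<Rightarrow> 'a. generically (\<lambda>x. f x = g x))"
    by (rule sympI) (simp add: eq_commute)
  show "transp (\<lambda>f g :: ('i \<Rightarrow> 'a) \<Rightarrow> 'a. generically (\<lambda>x. f x = g x))"
    by (rule transpI) (auto elim: generically_conj_mono)
qed

instantiation generic_power :: (type, field_char_0) field
begin

lift_definition zero_generic_power :: "('a, 'b) generic_power" is "\<lambda>_. 0" .
lift_definition one_generic_power :: "('a, 'b) generic_power" is "\<lambda>_. 1" .
lift_definition plus_generic_power :: "('a, 'b) generic_power \<Rightarrow> ('a, 'b) generic_power \<Rightarrow> ('a, 'b) generic_power"
  is "\<lambda>f g x. f x + g x" by (auto elim: generically_conj_mono)
lift_definition minus_generic_power :: "('a, 'b) generic_power \<Rightarrow> ('a, 'b) generic_power \<Rightarrow> ('a, 'b) generic_power"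
  is "\<lambda>f g x. f x - g x" by (auto elim: generically_conj_mono)
lift_definition times_generic_power :: "('a, 'b) generic_power \<Rightarrow> ('a, 'b) generic_power \<Rightarrow> ('a, 'b) generic_power"
  is "\<lambda>f g x. f x * g x" by (auto elim: generically_conj_mono)
lift_definition uminus_generic_power :: "('a, 'b) generic_power \<Rightarrow> ('a, 'b) generic_power"
  is "\<lambda>f x. - f x" by (auto elim: generically_mono)
lift_definition inverse_generic_power :: "('a, 'b) generic_power \<Rightarrow> ('a, 'b) generic_power"
  is "\<lambda>f x. inverse (f x)" by (auto elim: generically_mono)
lift_definition divide_generic_power :: "('a, 'b) generic_power \<Rightarrow> ('a, 'b) generic_power \<Rightarrow> ('a, 'b) generic_power"
  is "\<lambda>f g x. f x / g x" by (auto elim: generically_conj_mono)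

instance
proof
  fix a b c :: "('a, 'b) generic_power"
  show "a * b * c = a * (b * c)" by transfer (simp add: algebra_simps)
  show "a * b = b * a" by transfer (simp add: algebra_simps)
  show "1 * a = a" by transfer simp
  show "a + b + c = a + (b + c)" by transfer (simp add: algebra_simps)
  show "a + b = b + a" by transfer (simp add: algebra_simps)
  show "0 + a = a" by transfer simp
  show "- a + a = 0" by transfer simp
  show "a - b = a + - b" by transfer simp
  show "(a + b) * c = a * c + b * c" by transfer (simp add: algebra_simps)
  show "(0 :: ('a, 'b) generic_power) \<noteq> 1" by transfer simp
  \<comment> \<open>The ultrafilter decides every set, so a function that is not generically zero is
    generically nonzero and can be inverted there.\<close>
  show "a \<noteq> 0 \<Longrightarrow> inverse a * a = 1"
  proof transfer
    fix f :: "('a \<Rightarrow> 'b) \<Rightarrow> 'b"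
    assume "\<not> generically (\<lambda>x. f x = 0)"
    then have "generically (\<lambda>x. f x \<noteq> 0)" using generically_not by blast
    then show "generically (\<lambda>x. inverse (f x) * f x = 1)" by (rule generically_mono) simp
  qed
  show "a div b = a * inverse b" by transfer (simp add: divide_inverse)
  show "inverse (0 :: ('a, 'b) generic_power) = 0" by transfer simp
qed

end

lemma abs_generic_power_of_nat: "abs_generic_power (\<lambda>_. of_nat n) = of_nat n"
  by (induction n) (simp_all add: zero_generic_power.abs_eq[symmetric] one_generic_power.abs_eq
      plus_generic_power.abs_eq[symmetric])

instance generic_power :: (type, field_char_0) field_char_0
proof
  show "inj (of_nat :: nat \<Rightarrow> ('a, 'b) generic_power)"
  proof (rule injI)
    fix m n assume "(of_nat m :: ('a, 'b) generic_power) = of_nat n"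
    then have "generically (\<lambda>x :: 'a \<Rightarrow> 'b. (of_nat m :: 'b) = of_nat n)"
      by (simp add: abs_generic_power_of_nat[symmetric] generic_power.abs_eq_iff)
    then show "m = n" using generically_ex by fastforce
  qed
qed

lemma abs_generic_power_sum:
  "abs_generic_power (\<lambda>x. \<Sum>i\<in>I. f i x) = (\<Sum>i\<in>I. abs_generic_power (f i))"
  by (induction I rule: infinite_finite_induct)
    (simp_all add: zero_generic_power.abs_eq plus_generic_power.abs_eq[symmetric])

lemma abs_generic_power_prod:
  "abs_generic_power (\<lambda>x. \<Prod>i\<in>I. f i x) = (\<Prod>i\<in>I. abs_generic_power (f i))"
  by (induction I rule: infinite_finite_induct)
    (simp_all add: one_generic_power.abs_eq times_generic_power.abs_eq[symmetric])

text \<open>\<open>generic_const\<close> embeds the ground field, and the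
  \<open>generic_var i\<close> are the coordinates of a generic point. Other elements come from
  arbitrary functions of the point, so any pointwise choice defines one.\<close>

definition generic_const :: "'a::field_char_0 \<Rightarrow> ('i, 'a) generic_power" where
  "generic_const c = abs_generic_power (\<lambda>_. c)"

definition generic_var :: "'i \<Rightarrow> ('i, 'a::field_char_0) generic_power" where
  "generic_var i = abs_generic_power (\<lambda>x. x i)"

text \<open>Classes of polynomial functions paired with classes of their partial derivatives form a
  derivation graph: a function that is generically zero is zero, and so is its derivative. This
  derivation then extends to the whole ultrapower.\<close>

lemma generic_derivation_exists:
  fixes i :: 'i
  shows "\<exists>D :: ('i, 'a::field_char_0) generic_power \<Rightarrow> ('i, 'a) generic_power.
    (\<forall>x y. D (x + y) = D x + D y) \<and> (\<forall>x y. D (x * y) = x * D y + D x * y) \<and>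
    (\<forall>c. D (generic_const c) = 0) \<and> (\<forall>j. D (generic_var j) = (if j = i then 1 else 0))"
proof -
  define B :: "(('i, 'a) generic_power \<times> ('i, 'a) generic_power) set" where
    "B = {(abs_generic_power f, abs_generic_power f') | f f'. partial_deriv i f f'}"
  have memI: "(abs_generic_power f, abs_generic_power f') \<in> B" if "partial_deriv i f f'" for f f'
    unfolding B_def mem_Collect_eq using that by (intro exI conjI) simp_all
  have "dual_subring B"
    unfolding dual_subring_def
  proof (intro conjI allI impI)
    show "(1, 0) \<in> B"
      using memI[OF partial_deriv_const[of i 1]]
      by (simp add: one_generic_power.abs_eq zero_generic_power.abs_eq)
    fix x x' y y' assume "(x, x') \<in> B" "(y, y') \<in> B"
    then obtain f f' g g' where f: "partial_deriv i f f'" "x = abs_generic_power f" "x' = abs_generic_power f'"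
      and g: "partial_deriv i g g'" "y = abs_generic_power g" "y' = abs_generic_power g'"
      unfolding B_def by blast
    show "(x - y, x' - y') \<in> B"
      using memI[OF partial_deriv_diff[OF f(1) g(1)]] by (simp add: f g minus_generic_power.abs_eq)
    show "(x * y, x * y' + x' * y) \<in> B"
      using memI[OF partial_deriv_mult[OF f(1) g(1)]]
      by (simp add: f g times_generic_power.abs_eq plus_generic_power.abs_eq)
  qed
  moreover have "x' = 0" if x': "(0, x') \<in> B" for x'
  proof -
    obtain f f' where f: "partial_deriv i f f'" "0 = abs_generic_power f" "x' = abs_generic_power f'"
      using x' unfolding B_def by blast
    have "generically (\<lambda>x. f x = 0)"
      using f(2)[symmetric] by (simp add: zero_generic_power.abs_eq generic_power.abs_eq_iff)
    then have "f = (\<lambda>_. 0)"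
      using poly_fun_generically_zero poly_fun_if_partial_deriv[OF f(1)] by blast
    then have "f' = (\<lambda>_. 0)" using f(1) partial_deriv_zero[of i f'] by simp
    then show ?thesis using f(3) by (simp add: zero_generic_power.abs_eq)
  qed
  ultimately have "derivation_graph B" by (simp add: derivation_graph_def)
  from derivation_extends[OF this] obtain D where D: "\<forall>x y. D (x + y) = D x + D y"
    "\<forall>x y. D (x * y) = x * D y + D x * y" "\<forall>(x, x') \<in> B. D x = x'" by blast
  have "D (generic_const c) = 0" for c
    using D(3) memI[OF partial_deriv_const[of i c]] by (auto simp: generic_const_def zero_generic_power.abs_eq)
  moreover have "D (generic_var j) = (if j = i then 1 else 0)" for j
    using D(3) memI[OF partial_deriv_var[of i j]]
    by (cases "j = i") (auto simp: generic_var_def zero_generic_power.abs_eq one_generic_power.abs_eq)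
  ultimately show ?thesis using D(1,2) by blast
qed

section \<open>Waring decompositions and polarization\<close>

text \<open>Decompositions with exactly r terms, zero forms allowed, are handled instead of
  \<open>wrk\<close>, because a \<open>LEAST\<close> carries no information until some decomposition
  is known.\<close>

definition waring_sum :: "nat \<Rightarrow> nat \<Rightarrow> nat \<Rightarrow> 'a::field mpoly \<Rightarrow> bool" where
  "waring_sum m k r f \<longleftrightarrow> (\<exists>c :: nat \<Rightarrow> nat \<Rightarrow> 'a. f = (\<Sum>i<r. linear_form m (c i) ^ k))"

lemma wrk_le: "waring_sum m k r f \<Longrightarrow> wrk m k f \<le> r"
  unfolding wrk_def waring_sum_def by (rule Least_le)

lemma waring_sum_wrk: "waring_sum m k r f \<Longrightarrow> waring_sum m k (wrk m k f) f"
  unfolding wrk_def waring_sum_def by (rule LeastI)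

lemma linear_form_zero: "linear_form m (\<lambda>_. 0) = 0"
  by (simp add: linear_form_def)

lemma linear_form_add: "linear_form m c + linear_form m c' = linear_form m (\<lambda>i. c i + c' i)"
  by (simp add: linear_form_def single_add sum.distrib)

lemma linear_form_smult:
  "Poly_Mapping.single 0 a * linear_form m c = linear_form m (\<lambda>i. a * c i)"
  by (simp add: linear_form_def sum_distrib_left mult_single)

lemma linear_form_diff: "linear_form m c - linear_form m c' = linear_form m (\<lambda>i. c i - c' i)"
  by (simp add: linear_form_def single_diff sum_subtractf)

lemma waring_sum_mono:
  assumes "waring_sum m k r f" "r \<le> s" "k > 0"
  shows "waring_sum m k s f"
proof -
  obtain c where c: "f = (\<Sum>i<r. linear_form m (c i) ^ k)"
    using assms(1) unfolding waring_sum_def by blast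
  \<comment> \<open>Padding by zero forms, whose powers vanish because k > 0.\<close>
  have "f = (\<Sum>i<s. linear_form m (if i < r then c i else (\<lambda>_. 0)) ^ k)"
    unfolding c using assms(2,3)
    by (intro sum.mono_neutral_cong_left) (auto simp: linear_form_zero power_0_left)
  then show ?thesis
    unfolding waring_sum_def by (rule exI[of _ "\<lambda>i. if i < r then c i else (\<lambda>_. 0)"])
qed

lemma waring_sum_zero: "waring_sum m k 0 0"
  by (simp add: waring_sum_def)

lemma waring_sum_add:
  assumes "waring_sum m k r f" "waring_sum m k s g"
  shows "waring_sum m k (r + s) (f + g)"
proof -
  obtain c where c: "f = (\<Sum>i<r. linear_form m (c i) ^ k)"
    using assms(1) unfolding waring_sum_def by blast
  obtain c' where c': "g = (\<Sum>i<s. linear_form m (c' i) ^ k)"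
    using assms(2) unfolding waring_sum_def by blast
  let ?c = "\<lambda>i. if i < r then c i else c' (i - r)"
  have "{..<r + s} = {..<r} \<union> {r..<r + s}" by auto
  then have "(\<Sum>i<r + s. linear_form m (?c i) ^ k) =
      (\<Sum>i<r. linear_form m (?c i) ^ k) + (\<Sum>i=r..<r + s. linear_form m (?c i) ^ k)"
    by (metis (no_types, lifting) finite_atLeastLessThan finite_lessThan ivl_disj_int_one(2) sum.union_disjoint)
  also have "(\<Sum>i=r..<r + s. linear_form m (?c i) ^ k) = g"
    unfolding c' by (rule sum.reindex_bij_witness[of _ "\<lambda>i. i + r" "\<lambda>i. i - r"]) auto
  finally have "f + g = (\<Sum>i<r + s. linear_form m (?c i) ^ k)"
    by (simp add: c)
  then show ?thesis unfolding waring_sum_def by (rule exI[of _ ?c])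
qed

lemma single_zero_power: "Poly_Mapping.single 0 b ^ k = Poly_Mapping.single 0 (b ^ k)"
  by (induction k) (simp_all add: mult_single)

text \<open>The scalar moves into the linear forms through a k-th root, which exists over an
  algebraically closed field.\<close>

lemma waring_sum_smult:
  fixes f :: "'a::alg_closed_field mpoly"
  assumes "waring_sum m k r f" "k > 0"
  shows "waring_sum m k r (Poly_Mapping.single 0 a * f)"
proof -
  obtain c where c: "f = (\<Sum>i<r. linear_form m (c i) ^ k)"
    using assms(1) unfolding waring_sum_def by blast
  obtain b where b: "b ^ k = a" using nth_root_exists[OF assms(2)] by blast
  have "Poly_Mapping.single 0 a * f = (\<Sum>i<r. linear_form m (\<lambda>j. b * c i j) ^ k)"
    unfolding c by (simp add: linear_form_smult[symmetric] power_mult_distrib single_zero_power b sum_distrib_left)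
  then show ?thesis unfolding waring_sum_def by (rule exI[of _ "\<lambda>i j. b * c i j"])
qed

lemma waring_sum_diff:
  fixes f :: "'a::alg_closed_field mpoly"
  assumes "waring_sum m k r f" "waring_sum m k s g" "k > 0"
  shows "waring_sum m k (r + s) (f - g)"
proof -
  have "Poly_Mapping.single 0 (-1 :: 'a) * g = - g"
    by (simp add: single_uminus)
  then show ?thesis
    using waring_sum_add[OF assms(1) waring_sum_smult[OF assms(2,3), of "-1"]] by simp
qed

lemma waring_sum_sum:
  fixes f :: "'b \<Rightarrow> 'a::field mpoly"
  assumes "finite I" "\<And>i. i \<in> I \<Longrightarrow> waring_sum m k r (f i)"
  shows "waring_sum m k (card I * r) (sum f I)"
  using assms
proof (induction I)
  case empty
  then show ?case by (simp add: waring_sum_zero)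
next
  case (insert i I)
  then show ?case using waring_sum_add[of m k r "f i"] by simp
qed

text \<open>Polarization by symmetric differences needs one shift fewer than the degree, since
  even-order terms cancel: whence the factor 2^(k-1) instead of 2^k.\<close>
fun iter_diff :: "'r::comm_ring_1 list \<Rightarrow> ('r \<Rightarrow> 'r) \<Rightarrow> 'r \<Rightarrow> 'r" where
  "iter_diff [] f y = f y"
| "iter_diff (l # ls) f y = iter_diff ls f (y + l) - iter_diff ls f (y - l)"

text \<open>Shifts commute, so the outermost difference can be applied to the function first; on a
  power this permits the binomial expansion.\<close>

lemma iter_diff_commute:
  "iter_diff ls f (y + l) - iter_diff ls f (y - l) = iter_diff ls (\<lambda>y. f (y + l) - f (y - l)) y"
proof (induction ls arbitrary: y)
  case (Cons a ls)
  have "iter_diff ls f (y + l + a) - iter_diff ls f (y + l - a)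
      - (iter_diff ls f (y - l + a) - iter_diff ls f (y - l - a))
     = (iter_diff ls f (y + a + l) - iter_diff ls f (y + a - l))
      - (iter_diff ls f (y - a + l) - iter_diff ls f (y - a - l))"
    by (simp add: algebra_simps)
  then show ?case by (simp only: iter_diff.simps Cons.IH)
qed simp

lemma iter_diff_linear:
  "iter_diff ls (\<lambda>y. \<Sum>i\<in>I. c i * f i y) y = (\<Sum>i\<in>I. c i * iter_diff ls (f i) y)"
  by (induction ls arbitrary: y) (simp_all add: sum_subtractf right_diff_distrib)

lemma symmetric_diff_power:
  fixes y l :: "'r::comm_ring_1"
  shows "(y + l) ^ N - (y - l) ^ N =
    (\<Sum>j\<le>N. (if odd j then 2 * of_nat (N choose j) * l ^ j else 0) * y ^ (N - j))"
proof -
  have "(y + l) ^ N = (\<Sum>j\<le>N. of_nat (N choose j) * l ^ j * y ^ (N - j))"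
    using binomial_ring[of l y N] by (simp add: add.commute)
  moreover have "(y - l) ^ N = (\<Sum>j\<le>N. of_nat (N choose j) * (- l) ^ j * y ^ (N - j))"
    using binomial_ring[of "- l" y N] by simp
  ultimately show ?thesis
    by (simp add: sum_subtractf[symmetric]) (intro sum.cong, auto simp: algebra_simps)
qed

lemma iter_diff_power_Cons:
  "iter_diff (l # ls) (\<lambda>y. y ^ N) y =
    (\<Sum>j\<le>N. (if odd j then 2 * of_nat (N choose j) * l ^ j else 0) * iter_diff ls (\<lambda>y. y ^ (N - j)) y)"
  by (simp only: iter_diff.simps iter_diff_commute symmetric_diff_power iter_diff_linear)

text \<open>Each symmetric difference lowers the degree by at least one, so more differences than
  the degree give zero.\<close>

lemma iter_diff_power_small: "N < length ls \<Longrightarrow> iter_diff ls (\<lambda>y. y ^ N) y = 0"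
proof (induction ls arbitrary: N)
  case (Cons l ls)
  have "iter_diff ls (\<lambda>y. y ^ (N - j)) y = 0" if "j \<le> N" "odd j" for j
    using that Cons.prems by (intro Cons.IH) (auto elim: oddE)
  then show ?case unfolding iter_diff_power_Cons by (intro sum.neutral) auto
qed simp

text \<open>In the expansion of the first difference only j = 1 survives: j = 2 drops out by parity,
  and j \<ge> 3 leaves a degree below the number of remaining shifts. The base point y plays the
  part of the last factor.\<close>

lemma iter_diff_power_Suc_length:
  "iter_diff ls (\<lambda>y. y ^ Suc (length ls)) y = 2 ^ length ls * fact (Suc (length ls)) * prod_list ls * y"
proof (induction ls)
  case (Cons l ls)
  let ?N = "Suc (Suc (length ls))"
  have "iter_diff (l # ls) (\<lambda>y. y ^ ?N) y =
     (\<Sum>j\<in>{1}. (if odd j then 2 * of_nat (?N choose j) * l ^ j else 0) * iter_diff ls (\<lambda>y. y ^ (?N - j)) y)"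
    unfolding iter_diff_power_Cons
  proof (rule sum.mono_neutral_right)
    show "\<forall>j\<in>{..?N} - {1}. (if odd j then 2 * of_nat (?N choose j) * l ^ j else 0) *
        iter_diff ls (\<lambda>y. y ^ (?N - j)) y = 0"
    proof
      fix j assume j: "j \<in> {..?N} - {1}"
      show "(if odd j then 2 * of_nat (?N choose j) * l ^ j else 0) *
        iter_diff ls (\<lambda>y. y ^ (?N - j)) y = 0"
      proof (cases "odd j")
        case True
        with j have "j \<ge> 3" by (auto elim!: oddE)
        have "iter_diff ls (\<lambda>y. y ^ (?N - j)) y = 0"
        proof (cases "?N - j < length ls")
          case True
          then show ?thesis by (rule iter_diff_power_small)
        next
          case False
          \<comment> \<open>Impossible case: 3 \<le> j \<le> \<open>?N\<close> makes
            \<open>?N - j\<close> smaller than \<open>length ls\<close>, without truncation of the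
            subtraction.\<close>
          with j \<open>j \<ge> 3\<close> show ?thesis by auto
        qed
        then show ?thesis by simp
      qed simp
    qed
  qed auto
  also have "\<dots> = 2 * of_nat ?N * l * iter_diff ls (\<lambda>y. y ^ Suc (length ls)) y"
    by simp
  also have "\<dots> = 2 ^ length (l # ls) * fact ?N * prod_list (l # ls) * y"
    unfolding Cons.IH by (simp add: algebra_simps del: of_nat_Suc)
  finally show ?case by simp
qed simp

text \<open>Each difference doubles the number of powers, and shifting keeps the argument a linear
  form.\<close>

lemma waring_sum_iter_diff:
  fixes cs :: "(nat \<Rightarrow> 'a::alg_closed_field) list"
  assumes "k > 0"
  shows "waring_sum m k (2 ^ length cs) (iter_diff (map (linear_form m) cs) (\<lambda>y. y ^ k) (linear_form m c))"
proof (induction cs arbitrary: c)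
  case Nil
  show ?case by (auto simp: waring_sum_def intro!: exI[of _ "\<lambda>_. c"])
next
  case (Cons a cs)
  show ?case
    using waring_sum_diff[OF Cons.IH Cons.IH assms]
    by (simp add: linear_form_add linear_form_diff mult_2)
qed

text \<open>Polarization with k - 1 of the forms as shifts and the remaining one as base point; the
  factor 2^(k-1) k! is invertible in characteristic zero.\<close>

lemma waring_sum_prod:
  fixes c :: "nat \<Rightarrow> nat \<Rightarrow> 'a::{alg_closed_field, field_char_0}"
  assumes "k > 0"
  shows "waring_sum m k (2 ^ (k - 1)) (\<Prod>j<k. linear_form m (c j))"
proof -
  obtain n where k: "k = Suc n" using assms by (auto simp: gr0_conv_Suc)
  let ?cs = "map c [0..<n]"
  let ?ls = "map (linear_form m) ?cs"
  let ?C = "2 ^ n * fact k :: 'a"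
  have "prod_list ?ls = (\<Prod>j<n. linear_form m (c j))"
    by (simp add: prod.list_conv_set_nth atLeast0LessThan)
  then have "iter_diff ?ls (\<lambda>y. y ^ k) (linear_form m (c n)) =
      2 ^ n * fact k * (\<Prod>j<k. linear_form m (c j))"
    using iter_diff_power_Suc_length[of ?ls "linear_form m (c n)"] by (simp add: k algebra_simps)
  also have "2 ^ n * fact k = (Poly_Mapping.single 0 ?C :: 'a mpoly)"
    by (metis (mono_tags, lifting) of_nat_fact of_nat_mult of_nat_numeral of_nat_power single_of_nat)
  finally have *: "iter_diff ?ls (\<lambda>y. y ^ k) (linear_form m (c n)) =
      Poly_Mapping.single 0 ?C * (\<Prod>j<k. linear_form m (c j))" .
  have "waring_sum m k (2 ^ n) (Poly_Mapping.single 0 (inverse ?C) *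
      (Poly_Mapping.single 0 ?C * (\<Prod>j<k. linear_form m (c j))))"
    using waring_sum_smult[OF waring_sum_iter_diff[OF assms, of m ?cs "c n"] assms]
    unfolding * by simp
  moreover have "Poly_Mapping.single 0 (inverse ?C) * (Poly_Mapping.single 0 ?C * q) = q" for q :: "'a mpoly"
  proof -
    have "inverse ?C * ?C = 1" by (rule left_inverse) simp
    then show ?thesis by (simp only: mult.assoc[symmetric] mult_single add_0_left single_one mult_1_left)
  qed
  ultimately show ?thesis by (simp only: k diff_Suc_1)
qed

section \<open>Coefficients of products of linear forms\<close>

definition index_monomial :: "nat \<Rightarrow> (nat \<Rightarrow> nat) \<Rightarrow> (nat \<Rightarrow>\<^sub>0 nat)" where
  "index_monomial k \<tau> = (\<Sum>j<k. Poly_Mapping.single (\<tau> j) 1)"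

text \<open>The coefficient of \<alpha> in the product of the k linear forms with coefficients L j,
  written out so that it makes sense for coefficients in any extension ring.\<close>
definition prod_coeff :: "nat \<Rightarrow> nat \<Rightarrow> (nat \<Rightarrow>\<^sub>0 nat) \<Rightarrow> (nat \<Rightarrow> nat \<Rightarrow> 'b::comm_ring_1) \<Rightarrow> 'b" where
  "prod_coeff k m \<alpha> L =
     (\<Sum>\<tau>\<in>{\<tau> \<in> {..<k} \<rightarrow>\<^sub>E {..<m}. index_monomial k \<tau> = \<alpha>}. \<Prod>j<k. L j (\<tau> j))"

lemma prod_single:
  "(\<Prod>j\<in>J. Poly_Mapping.single (f j) (c j)) =
     Poly_Mapping.single (\<Sum>j\<in>J. f j :: 'm::comm_monoid_add) (\<Prod>j\<in>J. c j :: 'a::comm_ring_1)"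
  by (induction J rule: infinite_finite_induct) (simp_all add: mult_single)

lemma finite_index_maps: "finite ({..<k::nat} \<rightarrow>\<^sub>E {..<m::nat})"
  by (intro finite_PiE) auto

lemma lookup_prod_linear_form:
  "Poly_Mapping.lookup (\<Prod>j<k. linear_form m (L j)) \<alpha> = prod_coeff k m \<alpha> L"
proof -
  have "(\<Prod>j<k. linear_form m (L j)) =
      (\<Sum>\<tau>\<in>{..<k} \<rightarrow>\<^sub>E {..<m}. Poly_Mapping.single (index_monomial k \<tau>) (\<Prod>j<k. L j (\<tau> j)))"
    unfolding linear_form_def
    by (subst prod_sum_PiE) (simp_all add: prod_single index_monomial_def)
  then show ?thesis
    by (simp add: lookup_sum lookup_single when_def prod_coeff_def finite_index_maps sum.inter_filter)
qed

lemma prod_coeff_eq_0: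
  "\<alpha> \<notin> index_monomial k ` ({..<k} \<rightarrow>\<^sub>E {..<m}) \<Longrightarrow> prod_coeff k m \<alpha> L = 0"
  unfolding prod_coeff_def by (intro sum.neutral) auto

lemma index_monomial_exists:
  assumes "Poly_Mapping.keys \<alpha> \<subseteq> {..<m}" "mono_degree \<alpha> = k"
  shows "\<exists>\<tau>. (\<forall>j<k. \<tau> j < m) \<and> \<alpha> = index_monomial k \<tau>"
proof -
  have deg: "mono_degree \<alpha> = (\<Sum>i<m. Poly_Mapping.lookup \<alpha> i)"
    if "Poly_Mapping.keys \<alpha> \<subseteq> {..<m}" for \<alpha>
    unfolding mono_degree_def using that
    by (intro sum.mono_neutral_left) (auto simp: in_keys_iff)
  show ?thesis
    using assms
  proof (induction k arbitrary: \<alpha>)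
    case 0
    then have "\<alpha> = 0"
      by (intro poly_mapping_eqI) (auto simp: mono_degree_def in_keys_iff)
    then show ?case by (simp add: index_monomial_def)
  next
    case (Suc k)
    then obtain i where i: "i \<in> Poly_Mapping.keys \<alpha>"
      by (force simp: mono_degree_def)
    define \<beta> where "\<beta> = \<alpha> - Poly_Mapping.single i 1"
    have \<alpha>: "\<alpha> = \<beta> + Poly_Mapping.single i 1"
      using i by (intro poly_mapping_eqI)
        (auto simp: \<beta>_def lookup_add lookup_minus lookup_single when_def in_keys_iff)
    have sub: "Poly_Mapping.keys \<beta> \<subseteq> {..<m}"
    proof
      fix x assume "x \<in> Poly_Mapping.keys \<beta>"
      then have "x \<in> Poly_Mapping.keys \<alpha>" by (auto simp: \<alpha> in_keys_iff lookup_add)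
      then show "x \<in> {..<m}" using Suc.prems(1) by blast
    qed
    have im: "i < m" using i Suc.prems(1) by auto
    have "(\<Sum>x<m. Poly_Mapping.lookup \<alpha> x) = (\<Sum>x<m. Poly_Mapping.lookup \<beta> x) + 1"
      using im by (simp add: \<alpha> lookup_add sum.distrib lookup_single when_def)
    then have "mono_degree \<beta> = k"
      using deg[OF sub] deg[OF Suc.prems(1)] Suc.prems(2) by simp
    from Suc.IH[OF sub this] obtain \<tau> where \<tau>: "\<forall>j<k. \<tau> j < m" "\<beta> = index_monomial k \<tau>" by blast
    show ?case
    proof (intro exI conjI)
      show "\<forall>j<Suc k. (\<tau>(k := i)) j < m" using \<tau>(1) im by (simp add: less_Suc_eq)
      show "\<alpha> = index_monomial (Suc k) (\<tau>(k := i))"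
        by (simp add: index_monomial_def \<alpha> \<tau>(2))
    qed
  qed
qed

text \<open>A monomial of degree k is a product of k variables, so polarization applies to it.
  Existence is what makes \<open>wrk\<close> meaningful.\<close>

lemma waring_sum_exists:
  fixes p :: "'a::{alg_closed_field, field_char_0} mpoly"
  assumes "p \<in> P m k" "k > 0"
  shows "\<exists>r. waring_sum m k r p"
proof -
  have mono: "waring_sum m k (2 ^ (k - 1)) (Poly_Mapping.single \<alpha> c)"
    if \<alpha>: "\<alpha> \<in> Poly_Mapping.keys p" for \<alpha> and c :: 'a
  proof -
    obtain \<tau> where \<tau>: "\<forall>j<k. \<tau> j < m" "\<alpha> = index_monomial k \<tau>"
      using index_monomial_exists[of \<alpha> m k] \<alpha> assms(1) by (auto simp: P_def)
    have "(\<Prod>j<k. linear_form m (\<lambda>a. if a = \<tau> j then 1 else 0)) =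
        (\<Prod>j<k. Poly_Mapping.single (Poly_Mapping.single (\<tau> j) 1) (1 :: 'a))"
    proof (rule prod.cong)
      fix j assume "j \<in> {..<k}"
      then have "\<tau> j \<in> {..<m}" using \<tau>(1) by auto
      have "linear_form m (\<lambda>a. if a = \<tau> j then 1 else 0 :: 'a) =
          (\<Sum>i<m. if i = \<tau> j then Poly_Mapping.single (Poly_Mapping.single i 1) 1 else 0)"
        unfolding linear_form_def by (intro sum.cong) auto
      also have "\<dots> = Poly_Mapping.single (Poly_Mapping.single (\<tau> j) 1) 1"
        using \<open>\<tau> j \<in> {..<m}\<close> by (simp del: lessThan_iff)
      finally show "linear_form m (\<lambda>a. if a = \<tau> j then 1 else 0 :: 'a) =
          Poly_Mapping.single (Poly_Mapping.single (\<tau> j) 1) 1" .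
    qed simp
    then have "(\<Prod>j<k. linear_form m (\<lambda>a. if a = \<tau> j then 1 else 0 :: 'a)) = Poly_Mapping.single \<alpha> 1"
      by (simp add: prod_single \<tau>(2) index_monomial_def)
    then have "waring_sum m k (2 ^ (k - 1)) (Poly_Mapping.single \<alpha> (1 :: 'a))"
      using waring_sum_prod[OF assms(2), of m "\<lambda>j a. if a = \<tau> j then 1 else 0 :: 'a"] by simp
    from waring_sum_smult[OF this assms(2), of c] show ?thesis by (simp add: mult_single)
  qed
  have "(\<Sum>\<alpha>\<in>Poly_Mapping.keys p. Poly_Mapping.single \<alpha> (Poly_Mapping.lookup p \<alpha>)) = p"
    by (intro poly_mapping_eqI) (simp add: lookup_sum lookup_single when_def in_keys_iff)
  moreover have "waring_sum m k (card (Poly_Mapping.keys p) * 2 ^ (k - 1))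
      (\<Sum>\<alpha>\<in>Poly_Mapping.keys p. Poly_Mapping.single \<alpha> (Poly_Mapping.lookup p \<alpha>))"
    by (rule waring_sum_sum[OF finite_keys mono])
  ultimately show ?thesis by auto
qed

section \<open>Iterated derivations of products\<close>

locale coordinate_derivations =
  fixes D :: "nat \<times> nat \<Rightarrow> 'k::field_char_0 \<Rightarrow> 'k" and X :: "nat \<times> nat \<Rightarrow> 'k"
  assumes D_add: "D p (x + y) = D p x + D p y"
    and D_mult: "D p (x * y) = x * D p y + D p x * y"
    and D_var: "D p (X q) = (if q = p then 1 else 0)"
begin

lemma D_0: "D p 0 = 0"
  using D_add[of p 0 0] by simp

lemma D_1: "D p 1 = 0"
  using D_mult[of p 1 1] by simp

lemma D_sum: "D p (\<Sum>i\<in>I. f i) = (\<Sum>i\<in>I. D p (f i))"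
  by (induction I rule: infinite_finite_induct) (simp_all add: D_0 D_add)

lemma D_prod:
  assumes "finite J"
  shows "D p (\<Prod>j\<in>J. f j) = (\<Sum>w\<in>J. \<Prod>j\<in>J. if w = j then D p (f j) else f j)"
  using assms
proof (induction J)
  case empty
  then show ?case by (simp add: D_1)
next
  case (insert a J)
  have 1: "(\<Prod>j\<in>J. if a = j then D p (f j) else f j) = (\<Prod>j\<in>J. f j)"
    using insert.hyps by (intro prod.cong) auto
  have "(\<Sum>w\<in>J. \<Prod>j\<in>insert a J. if w = j then D p (f j) else f j)
      = (\<Sum>w\<in>J. f a * (\<Prod>j\<in>J. if w = j then D p (f j) else f j))"
    using insert.hyps by (intro sum.cong) auto
  then show ?case using insert 1 by (simp add: D_mult sum_distrib_left)
qed

text \<open>Position l of the list names the coordinate used in slot s + l, and the head is applied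
  last. The order is fixed since the derivations, extended independently, need not commute.\<close>

fun iter_D :: "nat \<Rightarrow> nat list \<Rightarrow> 'k \<Rightarrow> 'k" where
  "iter_D s [] x = x"
| "iter_D s (y # ys) x = D (s, y) (iter_D (Suc s) ys x)"

text \<open>Only those derivations are applied whose position is marked j in the list ws.\<close>
fun part_D :: "nat \<Rightarrow> nat list \<Rightarrow> nat list \<Rightarrow> nat \<Rightarrow> 'k \<Rightarrow> 'k" where
  "part_D s (y # ys) (w # ws) j x =
     (if w = j then D (s, y) (part_D (Suc s) ys ws j x) else part_D (Suc s) ys ws j x)"
| "part_D s _ _ j x = x"

lemma iter_D_sum: "iter_D s ys (\<Sum>i\<in>I. f i) = (\<Sum>i\<in>I. iter_D s ys (f i))"
  by (induction ys arbitrary: s) (simp_all add: D_sum)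

text \<open>The Leibniz rule: each ws records which factor receives which derivation.\<close>

lemma iter_D_prod:
  "iter_D s ys (\<Prod>j<k. f j) =
     (\<Sum>ws\<in>{ws. set ws \<subseteq> {..<k} \<and> length ws = length ys}. \<Prod>j<k. part_D s ys ws j (f j))"
proof (induction ys arbitrary: s)
  case Nil
  have "{ws. set ws \<subseteq> {..<k} \<and> length ws = length ([] :: nat list)} = {[]}" by auto
  then show ?case by simp
next
  case (Cons y ys)
  let ?W = "{ws. set ws \<subseteq> {..<k} \<and> length ws = length ys}"
  have inj: "inj_on (\<lambda>(ws, w). w # ws) (?W \<times> {..<k})" by (auto simp: inj_on_def)
  have "iter_D s (y # ys) (\<Prod>j<k. f j) =
      (\<Sum>ws\<in>?W. \<Sum>w<k. \<Prod>j<k. part_D s (y # ys) (w # ws) j (f j))"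
    by (simp add: Cons.IH D_sum D_prod)
  also have "\<dots> = (\<Sum>ws\<in>(\<lambda>(ws, w). w # ws) ` (?W \<times> {..<k}). \<Prod>j<k. part_D s (y # ys) ws j (f j))"
    by (subst sum.reindex[OF inj]) (simp add: sum.cartesian_product case_prod_unfold del: part_D.simps)
  finally show ?case by (simp only: lists_length_Suc_eq[symmetric] length_Cons)
qed

text \<open>Serves both for ground field constants and for a variable of an earlier slot, which all
  later slots treat as constant.\<close>

lemma iter_D_const_mult:
  assumes "\<And>s' y. s' \<ge> s \<Longrightarrow> D (s', y) c = 0"
  shows "iter_D s ys (c * x) = c * iter_D s ys x"
  using assms
proof (induction ys arbitrary: s)
  case (Cons y ys)
  have "iter_D (Suc s) ys (c * x) = c * iter_D (Suc s) ys x"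
    using Cons.prems by (intro Cons.IH) simp
  then show ?case using Cons.prems by (simp add: D_mult)
qed simp

lemma iter_D_vars:
  "length xs = length ys \<Longrightarrow>
    iter_D s ys (\<Prod>j<length xs. X (s + j, xs ! j)) = (if xs = ys then 1 else 0)"
proof (induction xs ys arbitrary: s rule: list_induct2)
  case (Cons x xs y ys)
  have "(\<Prod>j<length (x # xs). X (s + j, (x # xs) ! j)) =
      X (s, x) * (\<Prod>j<length xs. X (Suc s + j, xs ! j))"
    by (simp only: length_Cons prod.lessThan_Suc_shift) simp
  moreover have "iter_D (Suc s) ys (X (s, x) * (\<Prod>j<length xs. X (Suc s + j, xs ! j))) =
      X (s, x) * iter_D (Suc s) ys (\<Prod>j<length xs. X (Suc s + j, xs ! j))"
    by (rule iter_D_const_mult) (simp add: D_var)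
  ultimately have "iter_D s (y # ys) (\<Prod>j<length (x # xs). X (s + j, (x # xs) ! j)) =
      D (s, y) (X (s, x) * (if xs = ys then 1 else 0))"
    by (simp only: iter_D.simps Cons.IH)
  also have "\<dots> = (if x # xs = y # ys then 1 else 0)"
    by (simp add: D_var D_0)
  finally show ?case .
qed simp

text \<open>What makes regrouping possible: factor j sees only those coordinates whose derivations
  it receives.\<close>

lemma part_D_cong:
  assumes "length ys = length ws" "length ys' = length ws"
    and "\<And>l. l < length ws \<Longrightarrow> ws ! l = j \<Longrightarrow> ys ! l = ys' ! l"
  shows "part_D s ys ws j x = part_D s ys' ws j x"
  using assms
proof (induction ws arbitrary: s ys ys')
  case (Cons w ws)
  obtain y zs y' zs' where ys: "ys = y # zs" "ys' = y' # zs'"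
    using Cons.prems(1,2) by (metis length_Suc_conv)
  have "part_D t zs ws j x = part_D t zs' ws j x" for t
    using Cons.prems ys by (intro Cons.IH) (auto dest: Cons.prems(3)[of "Suc _", simplified])
  moreover have "w = j \<Longrightarrow> y = y'" using Cons.prems(3)[of 0] ys by simp
  ultimately show ?case by (simp add: ys)
qed simp

end

text \<open>The k fibres partition d positions, so one has at least d/k of them; the rest number at
  most (k-1)d/k, and the floor may be taken as they form an integer.\<close>

lemma pigeonhole_fibre:
  assumes "length ws = d" "set ws \<subseteq> {..<k}" "k > 0"
  shows "\<exists>j<k. d - card {l. l < d \<and> ws ! l = j} \<le> ((k - 1) * d) div k"
proof -
  let ?F = "\<lambda>j. {l. l < d \<and> ws ! l = j}"
  have "\<exists>j<k. d \<le> k * card (?F j)"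
  proof (rule ccontr)
    assume "\<not> ?thesis"
    then have lt: "k * card (?F j) < d" if "j < k" for j using that by (meson not_le)
    have "{..<d} = (\<Union>j<k. ?F j)" using assms by (force simp: subset_iff)
    then have "d = card (\<Union>j<k. ?F j)" by (metis card_lessThan)
    also have "\<dots> = (\<Sum>j<k. card (?F j))"
      by (intro card_UN_disjoint) auto
    finally have sum: "d = (\<Sum>j<k. card (?F j))" .
    have "k * d = (\<Sum>j<k. k * card (?F j))"
      unfolding sum_distrib_left[symmetric] by (rule arg_cong[OF sum])
    also have "\<dots> < (\<Sum>j<k. d)"
      using lt assms(3) by (intro sum_strict_mono) auto
    finally show False by simp
  qed
  then obtain j where j: "j < k" "d \<le> k * card (?F j)" by blast
  have "k * (d - card (?F j)) \<le> (k - 1) * d"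
    using j(2) by (simp add: diff_mult_distrib diff_mult_distrib2)
  then have "d - card (?F j) \<le> ((k - 1) * d) div k"
    using assms(3) by (simp add: less_eq_div_iff_mult_less_eq mult.commute)
  then show ?thesis using j(1) by blast
qed

text \<open>The factor of a largest fibre of ws absorbs the summation over its own coordinates,
  so only the coordinates outside of that fibre contribute separate products.\<close>
lemma sum_prod_coeff_regroup:
  fixes g :: "nat list \<Rightarrow> nat \<Rightarrow> nat \<Rightarrow> 'k::comm_ring_1"
  assumes ws: "length ws = d" "set ws \<subseteq> {..<k}" "k > 0"
    and g: "\<And>ys ys' j. length ys = d \<Longrightarrow> length ys' = d \<Longrightarrow>
       (\<And>l. l < d \<Longrightarrow> ws ! l = j \<Longrightarrow> ys ! l = ys' ! l) \<Longrightarrow> g ys j = g ys' j"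
  shows "\<exists>(Z :: nat list set) M. finite Z \<and> card Z \<le> n ^ (((k - 1) * d) div k) \<and>
    (\<forall>\<alpha>. (\<Sum>ys\<in>{ys. set ys \<subseteq> {..<n} \<and> length ys = d}. T ys * prod_coeff k m \<alpha> (g ys)) =
         (\<Sum>z\<in>Z. prod_coeff k m \<alpha> (M z)))"
proof -
  obtain i where i: "i < k" "d - card {l. l < d \<and> ws ! l = i} \<le> ((k - 1) * d) div k"
    using pigeonhole_fibre[OF ws] by blast
  let ?F = "{l. l < d \<and> ws ! l = i}"
  let ?L = "{ys. set ys \<subseteq> {..<n} \<and> length ys = d}"
  define key where "key ys = map (\<lambda>l. if ws ! l = i then 0 else ys ! l) [0..<d]" for ys :: "nat list"
  define Z where "Z = key ` ?L"
  \<comment> \<open>Factor i absorbs the weights and the sum over a class; the other factors are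
    evaluated at the representative.\<close>
  define M where "M z j a = (if j = i then \<Sum>ys\<in>{ys \<in> ?L. key ys = z}. T ys * g ys i a else g z j a)" for z j a
  have finL: "finite ?L" using finite_lists_length_eq[of "{..<n}" d] by simp
  have finZ: "finite Z" using finL by (simp add: Z_def)
  have "card Z \<le> card (({..<d} - ?F) \<rightarrow>\<^sub>E {..<n})"
  proof (rule card_inj_on_le)
    let ?r = "\<lambda>z. restrict (\<lambda>l. z ! l) ({..<d} - ?F)"
    show "inj_on ?r Z"
    proof (rule inj_onI)
      fix z z' assume zz: "z \<in> Z" "z' \<in> Z" and eq: "?r z = ?r z'"
      show "z = z'"
      proof (rule nth_equalityI)
        show "length z = length z'" using zz by (auto simp: Z_def key_def)
        fix l assume "l < length z"
        then have l: "l < d" using zz by (auto simp: Z_def key_def)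
        show "z ! l = z' ! l"
        proof (cases "ws ! l = i")
          case True
          then show ?thesis using zz l by (auto simp: Z_def key_def)
        next
          case False
          then show ?thesis using fun_cong[OF eq, of l] l by simp
        qed
      qed
    qed
    show "?r ` Z \<subseteq> ({..<d} - ?F) \<rightarrow>\<^sub>E {..<n}"
      by (auto simp: Z_def key_def PiE_def Pi_def subset_iff)
    show "finite (({..<d} - ?F) \<rightarrow>\<^sub>E {..<n})" by (intro finite_PiE) auto
  qed
  also have "\<dots> = n ^ (d - card ?F)"
  proof -
    have "card ({..<d} - ?F) = d - card ?F"
      by (subst card_Diff_subset) auto
    then show ?thesis by (subst card_PiE) simp_all
  qed
  finally have cardZ: "card Z \<le> n ^ (d - card ?F)" .
  have "card Z \<le> n ^ (((k - 1) * d) div k)"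
  \<comment> \<open>Monotonicity of powers requires n \<ge> 1. For n = 0 < d there are no index
    lists, and for d = 0 both exponents are 0.\<close>
  proof (cases "n = 0")
    case True
    show ?thesis
    proof (cases "d = 0")
      case d: False
      then have "Z = {}" using True by (auto simp: Z_def)
      then show ?thesis by simp
    qed (use cardZ in simp)
  next
    case False
    then have "n ^ (d - card ?F) \<le> n ^ (((k - 1) * d) div k)"
      by (intro power_increasing[OF i(2)]) simp
    with cardZ show ?thesis by (rule order_trans)
  qed
  moreover have "(\<Sum>ys\<in>?L. T ys * prod_coeff k m \<alpha> (g ys)) = (\<Sum>z\<in>Z. prod_coeff k m \<alpha> (M z))" for \<alpha>
  proof -
    let ?A = "{\<tau> \<in> {..<k} \<rightarrow>\<^sub>E {..<m}. index_monomial k \<tau> = \<alpha>}"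
    have split: "(\<Prod>j<k. h j) = h i * (\<Prod>j\<in>{..<k} - {i}. h j)" for h :: "nat \<Rightarrow> 'k"
      using i(1) by (intro prod.remove) auto
    have gz: "(\<Prod>j\<in>{..<k} - {i}. g ys j (\<tau> j)) = (\<Prod>j\<in>{..<k} - {i}. g (key ys) j (\<tau> j))"
      if "ys \<in> ?L" for ys \<tau>
    proof (rule prod.cong)
      fix j assume j: "j \<in> {..<k} - {i}"
      have "g ys j = g (key ys) j"
        by (rule g) (use that j in \<open>auto simp: key_def\<close>)
      then show "g ys j (\<tau> j) = g (key ys) j (\<tau> j)" by simp
    qed simp
    have "(\<Sum>ys\<in>?L. T ys * (\<Prod>j<k. g ys j (\<tau> j))) = (\<Sum>z\<in>Z. \<Prod>j<k. M z j (\<tau> j))" for \<tau>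
    proof -
      have "(\<Sum>ys\<in>?L. T ys * (\<Prod>j<k. g ys j (\<tau> j))) =
          (\<Sum>z\<in>Z. \<Sum>ys\<in>{ys \<in> ?L. key ys = z}. T ys * (\<Prod>j<k. g ys j (\<tau> j)))"
        unfolding Z_def by (rule sum.image_gen[OF finL])
      also have "\<dots> = (\<Sum>z\<in>Z. \<Prod>j<k. M z j (\<tau> j))"
      proof (rule sum.cong)
        fix z assume "z \<in> Z"
        have "(\<Sum>ys\<in>{ys \<in> ?L. key ys = z}. T ys * (\<Prod>j<k. g ys j (\<tau> j))) =
            (\<Sum>ys\<in>{ys \<in> ?L. key ys = z}. T ys * g ys i (\<tau> i) * (\<Prod>j\<in>{..<k} - {i}. g z j (\<tau> j)))"
          using gz by (intro sum.cong) (auto simp: split mult.assoc)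
        also have "\<dots> = M z i (\<tau> i) * (\<Prod>j\<in>{..<k} - {i}. M z j (\<tau> j))"
          by (simp add: M_def sum_distrib_right)
        finally show "(\<Sum>ys\<in>{ys \<in> ?L. key ys = z}. T ys * (\<Prod>j<k. g ys j (\<tau> j))) = (\<Prod>j<k. M z j (\<tau> j))"
          by (simp only: split)
      qed simp
      finally show ?thesis .
    qed
    note this[symmetric]
    then have "(\<Sum>z\<in>Z. prod_coeff k m \<alpha> (M z)) = (\<Sum>\<tau>\<in>?A. \<Sum>ys\<in>?L. T ys * (\<Prod>j<k. g ys j (\<tau> j)))"
      unfolding prod_coeff_def by (subst sum.swap) simp
    also have "\<dots> = (\<Sum>ys\<in>?L. T ys * prod_coeff k m \<alpha> (g ys))"
      unfolding prod_coeff_def by (subst sum.swap) (simp add: sum_distrib_left)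
    finally show ?thesis by simp
  qed
  ultimately show ?thesis using finZ by blast
qed

section \<open>Transfer between points and the ultrapower\<close>

lemma abs_generic_power_prod_coeff:
  "abs_generic_power (\<lambda>x. prod_coeff k m \<alpha> (\<lambda>j a. L j a x)) =
     prod_coeff k m \<alpha> (\<lambda>j a. abs_generic_power (L j a))"
  by (simp only: prod_coeff_def abs_generic_power_sum abs_generic_power_prod)

lemma generic_const_sum_mult:
  "generic_const (\<Sum>y\<in>Y. a y * b y) = (\<Sum>y\<in>Y. generic_const (a y) * generic_const (b y))"
  by (simp only: generic_const_def abs_generic_power_sum times_generic_power.abs_eq)

text \<open>\<open>A xs\<close> lists the coefficients of the image of a unit tensor. Coefficients
  are compared on a finite S because an ultrafilter is closed under finite intersections only. An
  index in Q records a power i, a distribution ws of the derivations and a class z of lists.\<close>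

lemma generic_decomposition_expand:
  fixes A :: "nat list \<Rightarrow> (nat \<Rightarrow>\<^sub>0 nat) \<Rightarrow> 'a::field_char_0"
  assumes "k > 0"
    and decomp: "\<And>v :: nat \<times> nat \<Rightarrow> 'a. \<exists>c. \<forall>\<alpha>.
      (\<Sum>xs\<in>{xs. set xs \<subseteq> {..<n} \<and> length xs = d}. (\<Prod>j<d. v (j, xs ! j)) * A xs \<alpha>) =
      (\<Sum>i<r. prod_coeff k m \<alpha> (\<lambda>j. c i))"
    and S: "finite S"
  shows "\<exists>Q h. finite (Q :: (nat \<times> nat list \<times> nat list) set) \<and>
     card Q \<le> r * k ^ d * n ^ (((k - 1) * d) div k) \<and>
     (\<forall>\<alpha>\<in>S. (\<Sum>xs\<in>{xs. set xs \<subseteq> {..<n} \<and> length xs = d}. T xs * A xs \<alpha>) =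
        (\<Sum>q\<in>Q. prod_coeff k m \<alpha> (h q)))"
proof -
  let ?L = "{xs. set xs \<subseteq> {..<n} \<and> length xs = d}"
  let ?W = "{ws. set ws \<subseteq> {..<k} \<and> length ws = d}"
  let ?fl = "((k - 1) * d) div k"
  have finL: "finite ?L" using finite_lists_length_eq[of "{..<n}" d] by simp
  have finW: "finite ?W" using finite_lists_length_eq[of "{..<k}" d] by simp
  have cardW: "card ?W = k ^ d" using card_lists_length_eq[of "{..<k}" d] by simp
  \<comment> \<open>One decomposition is picked at each point v, with no regularity in v; this
    already defines elements of the ultrapower.\<close>
  obtain c where c: "\<And>v \<alpha>. (\<Sum>xs\<in>?L. (\<Prod>j<d. v (j, xs ! j)) * A xs \<alpha>) =
      (\<Sum>i<r. prod_coeff k m \<alpha> (\<lambda>j. c v i))"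
    using decomp by metis
  define C :: "nat \<Rightarrow> nat \<Rightarrow> (nat \<times> nat, 'a) generic_power" where
    "C i a = abs_generic_power (\<lambda>v. c v i a)" for i a
  have "\<forall>p. \<exists>D :: (nat \<times> nat, 'a) generic_power \<Rightarrow> (nat \<times> nat, 'a) generic_power.
    (\<forall>x y. D (x + y) = D x + D y) \<and> (\<forall>x y. D (x * y) = x * D y + D x * y) \<and>
    (\<forall>c. D (generic_const c) = 0) \<and> (\<forall>j. D (generic_var j) = (if j = p then 1 else 0))"
    by (rule allI, rule generic_derivation_exists)
  then obtain D :: "nat \<times> nat \<Rightarrow> (nat \<times> nat, 'a) generic_power \<Rightarrow> (nat \<times> nat, 'a) generic_power" where
    D: "\<forall>p. (\<forall>x y. D p (x + y) = D p x + D p y) \<and> (\<forall>x y. D p (x * y) = x * D p y + D p x * y) \<and>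
    (\<forall>c. D p (generic_const c) = 0) \<and> (\<forall>j. D p (generic_var j) = (if j = p then 1 else 0))"
    by (elim choice[THEN exE])
  have D_const: "D p (generic_const a) = 0" for p a using D by blast
  interpret coordinate_derivations D generic_var
    by unfold_locales (use D in blast)+
  have eq: "(\<Sum>xs\<in>?L. (\<Prod>j<d. generic_var (j, xs ! j)) * generic_const (A xs \<alpha>)) =
      (\<Sum>i<r. prod_coeff k m \<alpha> (\<lambda>j. C i))" for \<alpha>
  proof -
    have "(\<Sum>xs\<in>?L. (\<Prod>j<d. generic_var (j, xs ! j)) * generic_const (A xs \<alpha>)) =
        abs_generic_power (\<lambda>v. \<Sum>xs\<in>?L. (\<Prod>j<d. v (j, xs ! j)) * A xs \<alpha>)"
      by (simp only: generic_var_def generic_const_def abs_generic_power_sum abs_generic_power_prod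
          times_generic_power.abs_eq[symmetric])
    also have "\<dots> = (\<Sum>i<r. prod_coeff k m \<alpha> (\<lambda>j. C i))"
      by (simp only: c C_def[abs_def] abs_generic_power_sum abs_generic_power_prod_coeff)
    finally show ?thesis .
  qed
  \<comment> \<open>One differentiation in each slot isolates the coefficient at ys on the left,
    while the Leibniz rule expands the powers on the right.\<close>
  have coeff: "generic_const (A ys \<alpha>) =
      (\<Sum>i<r. \<Sum>ws\<in>?W. prod_coeff k m \<alpha> (\<lambda>j a. part_D 0 ys ws j (C i a)))" if ys: "ys \<in> ?L" for ys \<alpha>
  proof -
    have "iter_D 0 ys (\<Sum>xs\<in>?L. (\<Prod>j<d. generic_var (j, xs ! j)) * generic_const (A xs \<alpha>)) =
        (\<Sum>xs\<in>?L. if xs = ys then generic_const (A xs \<alpha>) else 0)"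
      unfolding iter_D_sum
    proof (rule sum.cong)
      fix xs assume xs: "xs \<in> ?L"
      have "iter_D 0 ys ((\<Prod>j<d. generic_var (j, xs ! j)) * generic_const (A xs \<alpha>)) =
          generic_const (A xs \<alpha>) * iter_D 0 ys (\<Prod>j<length xs. generic_var (0 + j, xs ! j))"
        using xs by (subst mult.commute, subst iter_D_const_mult) (simp_all add: D_const)
      also have "\<dots> = generic_const (A xs \<alpha>) * (if xs = ys then 1 else 0)"
        using xs ys by (subst iter_D_vars) simp_all
      finally show "iter_D 0 ys ((\<Prod>j<d. generic_var (j, xs ! j)) * generic_const (A xs \<alpha>)) =
          (if xs = ys then generic_const (A xs \<alpha>) else 0)" by simp
    qed simp
    also have "\<dots> = generic_const (A ys \<alpha>)"
      using ys finL by (subst sum.delta) auto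
    finally have "generic_const (A ys \<alpha>) = iter_D 0 ys (\<Sum>i<r. prod_coeff k m \<alpha> (\<lambda>j. C i))"
      by (simp only: eq)
    also have "\<dots> = (\<Sum>i<r. \<Sum>\<tau>\<in>{\<tau> \<in> {..<k} \<rightarrow>\<^sub>E {..<m}. index_monomial k \<tau> = \<alpha>}.
        \<Sum>ws\<in>?W. \<Prod>j<k. part_D 0 ys ws j (C i (\<tau> j)))"
      using ys by (simp only: prod_coeff_def iter_D_sum iter_D_prod mem_Collect_eq)
    also have "\<dots> = (\<Sum>i<r. \<Sum>ws\<in>?W. prod_coeff k m \<alpha> (\<lambda>j a. part_D 0 ys ws j (C i a)))"
      unfolding prod_coeff_def by (intro sum.cong refl sum.swap)
    finally show ?thesis .
  qed
  have regroup: "\<exists>(Z :: nat list set) M. finite Z \<and> card Z \<le> n ^ ?fl \<and>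
      (\<forall>\<alpha>. (\<Sum>ys\<in>?L. generic_const (T ys) * prod_coeff k m \<alpha> (\<lambda>j a. part_D 0 ys ws j (C i a))) =
           (\<Sum>z\<in>Z. prod_coeff k m \<alpha> (M z)))" if ws: "ws \<in> ?W" for i ws
  proof (rule sum_prod_coeff_regroup)
    fix ys ys' :: "nat list" and j
    assume "length ys = d" "length ys' = d" "\<And>l. l < d \<Longrightarrow> ws ! l = j \<Longrightarrow> ys ! l = ys' ! l"
    then show "(\<lambda>a. part_D 0 ys ws j (C i a)) = (\<lambda>a. part_D 0 ys' ws j (C i a))"
      using ws by (intro ext part_D_cong) auto
  qed (use ws assms(1) in auto)
  define R where "R i ws ZM \<longleftrightarrow> finite (fst ZM) \<and> card (fst ZM) \<le> n ^ ?fl \<and>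
      (\<forall>\<alpha>. (\<Sum>ys\<in>?L. generic_const (T ys) * prod_coeff k m \<alpha> (\<lambda>j a. part_D 0 ys ws j (C i a))) =
           (\<Sum>z\<in>fst ZM. prod_coeff k m \<alpha> (snd ZM z)))"
    for i ws and ZM :: "nat list set \<times> (nat list \<Rightarrow> nat \<Rightarrow> nat \<Rightarrow> (nat \<times> nat, 'a) generic_power)"
  define Z where "Z i ws = fst (SOME ZM. R i ws ZM)" for i ws
  define M where "M i ws = snd (SOME ZM. R i ws ZM)" for i ws
  have R: "R i ws (Z i ws, M i ws)" if ws: "ws \<in> ?W" for i ws
  proof -
    from regroup[OF ws, of i] obtain Z' M' where "R i ws (Z', M')"
      unfolding R_def fst_conv snd_conv by (elim exE)
    then have "R i ws (SOME ZM. R i ws ZM)" by (rule someI)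
    then show ?thesis by (simp add: Z_def M_def)
  qed
  have Z: "\<And>i ws. ws \<in> ?W \<Longrightarrow> finite (Z i ws)" "\<And>i ws. ws \<in> ?W \<Longrightarrow> card (Z i ws) \<le> n ^ ?fl"
    and M: "\<And>i ws \<alpha>. ws \<in> ?W \<Longrightarrow>
      (\<Sum>ys\<in>?L. generic_const (T ys) * prod_coeff k m \<alpha> (\<lambda>j a. part_D 0 ys ws j (C i a))) =
      (\<Sum>z\<in>Z i ws. prod_coeff k m \<alpha> (M i ws z))"
    using R unfolding R_def by simp_all
  define Q where "Q = (SIGMA i:{..<r}. SIGMA ws:?W. Z i ws)"
  have finQ: "finite Q" unfolding Q_def using finW Z(1) by (intro finite_SigmaI) auto
  have "card Q = (\<Sum>i<r. \<Sum>ws\<in>?W. card (Z i ws))"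
    unfolding Q_def using finW Z(1) by (subst card_SigmaI) (auto intro!: finite_SigmaI sum.cong card_SigmaI)
  also have "\<dots> \<le> (\<Sum>i<r. \<Sum>ws\<in>?W. n ^ ?fl)" using Z(2) by (intro sum_mono) auto
  finally have cardQ: "card Q \<le> r * k ^ d * n ^ ?fl" by (simp add: cardW)
  \<comment> \<open>Representing functions, to be evaluated at a point where the identities for all
    \<alpha> in S hold at once.\<close>
  define rep where "rep q j a = rep_generic_power (case q of (i, ws, z) \<Rightarrow> M i ws z j a)" for q j a
  have gen: "generically (\<lambda>v. (\<Sum>xs\<in>?L. T xs * A xs \<alpha>) = (\<Sum>q\<in>Q. prod_coeff k m \<alpha> (\<lambda>j a. rep q j a v)))" for \<alpha>
  proof -
    have "generic_const (\<Sum>xs\<in>?L. T xs * A xs \<alpha>) =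
        (\<Sum>ys\<in>?L. \<Sum>i<r. \<Sum>ws\<in>?W. generic_const (T ys) * prod_coeff k m \<alpha> (\<lambda>j a. part_D 0 ys ws j (C i a)))"
      unfolding generic_const_sum_mult by (intro sum.cong refl) (simp only: coeff sum_distrib_left)
    also have "\<dots> = (\<Sum>i<r. \<Sum>ws\<in>?W. \<Sum>ys\<in>?L. generic_const (T ys) * prod_coeff k m \<alpha> (\<lambda>j a. part_D 0 ys ws j (C i a)))"
      by (subst sum.swap) (intro sum.cong refl sum.swap)
    also have "\<dots> = (\<Sum>i<r. \<Sum>ws\<in>?W. \<Sum>z\<in>Z i ws. prod_coeff k m \<alpha> (M i ws z))"
      by (intro sum.cong refl M)
    also have "\<dots> = (\<Sum>q\<in>Q. case q of (i, ws, z) \<Rightarrow> prod_coeff k m \<alpha> (M i ws z))"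
    proof -
      have "finite (SIGMA ws:?W. Z i ws)" for i using finW Z(1) by (intro finite_SigmaI)
      then show ?thesis
        unfolding Q_def using finW Z(1) by (simp add: sum.Sigma case_prod_unfold)
    qed
    also have "\<dots> = abs_generic_power (\<lambda>v. \<Sum>q\<in>Q. prod_coeff k m \<alpha> (\<lambda>j a. rep q j a v))"
      unfolding abs_generic_power_sum abs_generic_power_prod_coeff rep_def
        Quotient3_abs_rep[OF Quotient3_generic_power]
      by (intro sum.cong) auto
    finally show ?thesis
      unfolding generic_const_def generic_power.abs_eq_iff .
  qed
  have "generically (\<lambda>v. \<forall>\<alpha>\<in>S. (\<Sum>xs\<in>?L. T xs * A xs \<alpha>) = (\<Sum>q\<in>Q. prod_coeff k m \<alpha> (\<lambda>j a. rep q j a v)))"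
    by (rule generically_ball_finite[OF S gen])
  then obtain v where
    "\<forall>\<alpha>\<in>S. (\<Sum>xs\<in>?L. T xs * A xs \<alpha>) = (\<Sum>q\<in>Q. prod_coeff k m \<alpha> (\<lambda>j a. rep q j a v))"
    by (elim generically_ex[THEN exE])
  then show ?thesis using finQ cardQ by (intro exI[of _ Q] exI[of _ "\<lambda>q j a. rep q j a v"]) simp
qed

section \<open>The bound for tensors\<close>

definition unit_tensor :: "nat list \<Rightarrow> nat list \<Rightarrow> 'a::field" where
  "unit_tensor xs = (\<lambda>ys. if ys = xs then 1 else 0)"

lemma unit_tensor_in_rank_one:
  assumes "valid_index n d xs"
  shows "unit_tensor xs \<in> rank_one_tensors n d"
proof -
  have "unit_tensor xs = tensor_prod n d (\<lambda>j a. if a = xs ! j then 1 else 0 :: 'a)"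
  proof
    fix ys
    show "unit_tensor xs ys = tensor_prod n d (\<lambda>j a. if a = xs ! j then 1 else 0 :: 'a) ys"
    proof (cases "ys = xs")
      case True
      then show ?thesis using assms by (simp add: unit_tensor_def tensor_prod_def)
    next
      case False
      then have "\<exists>j<d. ys ! j \<noteq> xs ! j" if "valid_index n d ys"
        using that assms by (auto simp: valid_index_def list_eq_iff_nth_eq)
      then have "(\<Prod>j<d. if ys ! j = xs ! j then 1 else 0 :: 'a) = 0" if "valid_index n d ys"
        using that by (intro prod_zero) auto
      then show ?thesis using False by (simp add: unit_tensor_def tensor_prod_def)
    qed
  qed
  then show ?thesis unfolding rank_one_tensors_def by auto
qed

lemma rank_one_subset_Ten: "rank_one_tensors n d \<subseteq> Ten n d"
  by (auto simp: rank_one_tensors_def Ten_def tensor_prod_def)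

lemma lookup_linear_on:
  assumes lin: "linear_on (Ten n d) phi" and T: "T \<in> Ten n d"
  shows "Poly_Mapping.lookup (phi T) \<alpha> =
    (\<Sum>xs\<in>{xs. set xs \<subseteq> {..<n} \<and> length xs = d}. T xs * Poly_Mapping.lookup (phi (unit_tensor xs)) \<alpha>)"
proof -
  let ?L = "{xs. set xs \<subseteq> {..<n} \<and> length xs = d}"
  have L: "xs \<in> ?L \<longleftrightarrow> valid_index n d xs" for xs by (auto simp: valid_index_def)
  have finL: "finite ?L" using finite_lists_length_eq[of "{..<n}" d] by simp
  have lk: "Poly_Mapping.lookup (phi (\<lambda>xs. a * x xs + y xs)) \<alpha> =
      a * Poly_Mapping.lookup (phi x) \<alpha> + Poly_Mapping.lookup (phi y) \<alpha>"
    if "x \<in> Ten n d" "y \<in> Ten n d" for x y a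
    using lin that unfolding linear_on_def
    by (simp add: lookup_add Poly_Mapping.map.rep_eq when_def)
  have "Poly_Mapping.lookup (phi (\<lambda>ys. if ys \<in> S then T ys else 0)) \<alpha> =
      (\<Sum>xs\<in>S. T xs * Poly_Mapping.lookup (phi (unit_tensor xs)) \<alpha>)" if "finite S" "S \<subseteq> ?L" for S
    using that
  proof (induction S)
    case empty
    have "(\<lambda>_. 0) \<in> Ten n d" by (simp add: Ten_def)
    \<comment> \<open>Linearity for -1 times 0 plus 0 yields that \<open>phi\<close> vanishes at the
      zero tensor.\<close>
    from lk[OF this this, of "-1"] show ?case by simp
  next
    case (insert xs S)
    have u: "unit_tensor xs \<in> Ten n d"
      using unit_tensor_in_rank_one rank_one_subset_Ten insert.prems L by blast
    have t: "(\<lambda>ys. if ys \<in> S then T ys else 0) \<in> Ten n d"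
      using T by (simp add: Ten_def)
    have eq: "(\<lambda>ys. if ys \<in> insert xs S then T ys else 0) =
        (\<lambda>ys. T xs * unit_tensor xs ys + (if ys \<in> S then T ys else 0))"
      using insert.hyps by (auto simp: unit_tensor_def fun_eq_iff)
    show ?case unfolding eq lk[OF u t] using insert by simp
  qed
  from this[OF finL subset_refl]
  have "Poly_Mapping.lookup (phi (\<lambda>ys. if ys \<in> ?L then T ys else 0)) \<alpha> =
      (\<Sum>xs\<in>?L. T xs * Poly_Mapping.lookup (phi (unit_tensor xs)) \<alpha>)" .
  moreover have "(\<lambda>ys. if ys \<in> ?L then T ys else 0) = T"
    using T unfolding L by (auto simp: Ten_def fun_eq_iff)
  ultimately show ?thesis by simp
qed

text \<open>Combines the expansion, applied to the coefficients of \<open>phi\<close> on unit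
  tensors, with polarization of each resulting product.\<close>

lemma waring_sum_Ten:
  fixes phi :: "(nat list \<Rightarrow> 'a::{alg_closed_field, field_char_0}) \<Rightarrow> 'a mpoly"
  assumes k: "k > 0" and lin: "linear_on (Ten n d) phi"
    and simple: "\<And>S. S \<in> rank_one_tensors n d \<Longrightarrow> waring_sum m k r (phi S)"
    and T: "T \<in> Ten n d"
  shows "waring_sum m k (r * (2 ^ (k - 1) * k ^ d * n ^ (((k - 1) * d) div k))) (phi T)"
proof -
  let ?L = "{xs. set xs \<subseteq> {..<n} \<and> length xs = d}"
  define A where "A xs \<alpha> = Poly_Mapping.lookup (phi (unit_tensor xs)) \<alpha>" for xs \<alpha>
  \<comment> \<open>Outside this finite set the coefficients of \<open>phi T\<close> and of all
    products of k linear forms vanish.\<close>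
  define S where "S = Poly_Mapping.keys (phi T) \<union> index_monomial k ` ({..<k} \<rightarrow>\<^sub>E {..<m})"
  have "finite S" by (simp add: S_def finite_index_maps)
  have decomp: "\<exists>c. \<forall>\<alpha>. (\<Sum>xs\<in>?L. (\<Prod>j<d. v (j, xs ! j)) * A xs \<alpha>) = (\<Sum>i<r. prod_coeff k m \<alpha> (\<lambda>j. c i))"
    for v :: "nat \<times> nat \<Rightarrow> 'a"
  proof -
    let ?t = "tensor_prod n d (\<lambda>j a. v (j, a))"
    have t: "?t \<in> rank_one_tensors n d" by (auto simp: rank_one_tensors_def)
    obtain c where c: "phi ?t = (\<Sum>i<r. linear_form m (c i) ^ k)"
      using simple[OF t] unfolding waring_sum_def by blast
    have "(\<Sum>xs\<in>?L. (\<Prod>j<d. v (j, xs ! j)) * A xs \<alpha>) = (\<Sum>i<r. prod_coeff k m \<alpha> (\<lambda>j. c i))" for \<alpha>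
    proof -
      have "(\<Sum>xs\<in>?L. (\<Prod>j<d. v (j, xs ! j)) * A xs \<alpha>) = (\<Sum>xs\<in>?L. ?t xs * A xs \<alpha>)"
        by (intro sum.cong) (auto simp: tensor_prod_def valid_index_def)
      also have "\<dots> = Poly_Mapping.lookup (phi ?t) \<alpha>"
        unfolding A_def by (rule lookup_linear_on[OF lin subsetD[OF rank_one_subset_Ten t], symmetric])
      also have "\<dots> = (\<Sum>i<r. prod_coeff k m \<alpha> (\<lambda>j. c i))"
        by (simp add: c lookup_sum lookup_prod_linear_form[symmetric])
      finally show ?thesis .
    qed
    then show ?thesis by blast
  qed
  obtain Q :: "(nat \<times> nat list \<times> nat list) set" and h where Q: "finite Q"
    "card Q \<le> r * k ^ d * n ^ (((k - 1) * d) div k)"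
    "\<And>\<alpha>. \<alpha> \<in> S \<Longrightarrow> (\<Sum>xs\<in>?L. T xs * A xs \<alpha>) = (\<Sum>q\<in>Q. prod_coeff k m \<alpha> (h q))"
    using generic_decomposition_expand[OF k decomp \<open>finite S\<close>, of T] by blast
  have "phi T = (\<Sum>q\<in>Q. \<Prod>j<k. linear_form m (h q j))"
  proof (rule poly_mapping_eqI)
    fix \<alpha>
    show "Poly_Mapping.lookup (phi T) \<alpha> = Poly_Mapping.lookup (\<Sum>q\<in>Q. \<Prod>j<k. linear_form m (h q j)) \<alpha>"
    proof (cases "\<alpha> \<in> S")
      case True
      then show ?thesis
        using Q(3)[OF True] lookup_linear_on[OF lin T, of \<alpha>]
        by (simp add: A_def lookup_sum lookup_prod_linear_form)
    next
      case False
      then show ?thesis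
        by (auto simp: S_def lookup_sum lookup_prod_linear_form prod_coeff_eq_0 in_keys_iff)
    qed
  qed
  moreover have "waring_sum m k (card Q * 2 ^ (k - 1)) (\<Sum>q\<in>Q. \<Prod>j<k. linear_form m (h q j))"
    by (rule waring_sum_sum[OF Q(1) waring_sum_prod[OF k]])
  ultimately have "waring_sum m k (card Q * 2 ^ (k - 1)) (phi T)" by (simp only:)
  moreover have "card Q * 2 ^ (k - 1) \<le> r * (2 ^ (k - 1) * k ^ d * n ^ (((k - 1) * d) div k))"
    using mult_right_mono[OF Q(2), of "2 ^ (k - 1)"] by (simp add: ac_simps)
  ultimately show ?thesis using k by (rule waring_sum_mono)
qed

theorem theorem1p11:
  fixes phi :: "(nat list \<Rightarrow> 'a::{alg_closed_field, field_char_0}) \<Rightarrow> 'a mpoly"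
    and n m d k :: nat
  assumes "n \<ge> 1" "m \<ge> 1" "d \<ge> 1" "k \<ge> 1"
    and maps_into: "phi ` Ten n d \<subseteq> P m k"
    and lin: "linear_on (Ten n d) phi"
    and nonzero: "\<exists>T\<in>Ten n d. phi T \<noteq> 0"
  shows "Pot m k phi (Ten n d) (rank_one_tensors n d)
           \<le> ereal (real (2 ^ (k - 1) * k ^ d * n ^ (((k - 1) * d) div k)))"
proof -
  let ?S = "rank_one_tensors n d :: (nat list \<Rightarrow> 'a) set"
  let ?B = "2 ^ (k - 1) * k ^ d * n ^ (((k - 1) * d) div k)"
  have k: "k > 0" using \<open>k \<ge> 1\<close> by simp
  show ?thesis
  proof (cases "mu m k phi ?S")
    case infinity
    \<comment> \<open>x / \<infinity> = 0 for every extended real x, even for x = \<infinity>\<close>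
    then show ?thesis by (simp add: Pot_def)
  next
    case (enat r)
    have simple: "waring_sum m k r (phi S)" if "S \<in> ?S" for S
    proof -
      have "phi S \<in> P m k" using that maps_into rank_one_subset_Ten by blast
      \<comment> \<open>Some decomposition must exist before the \<open>LEAST\<close> in
        \<open>wrk\<close> yields one of minimal length, which is then padded to r terms.\<close>
      then obtain s where "waring_sum m k s (phi S)" using waring_sum_exists k by blast
      moreover have "enat (wrk m k (phi S)) \<le> mu m k phi ?S"
        unfolding mu_def using that by (rule SUP_upper)
      ultimately show ?thesis
        using waring_sum_mono[OF waring_sum_wrk _ k] enat by simp
    qed
    \<comment> \<open>For r = 0 every value of \<open>phi\<close> would be an empty sum of powers,
      against \<open>nonzero\<close>; so the denominator of the potential is positive.\<close>
    have "r > 0"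
    proof (rule ccontr)
      assume "\<not> r > 0"
      obtain T where T: "T \<in> Ten n d" "phi T \<noteq> 0" using nonzero by blast
      from waring_sum_Ten[OF k lin simple T(1)] \<open>\<not> r > 0\<close> T(2) show False
        by (simp add: waring_sum_def)
    qed
    have "mu m k phi (Ten n d) \<le> enat (r * ?B)"
      unfolding mu_def
      by (intro SUP_least) (use wrk_le[OF waring_sum_Ten[OF k lin simple]] in simp)
    then have "ereal_of_enat (mu m k phi (Ten n d)) \<le> ereal_of_enat (enat (r * ?B))"
      by (simp only: ereal_of_enat_le_iff)
    also have "\<dots> = ereal (real r) * ereal (real ?B)" by simp
    finally show ?thesis
      using \<open>r > 0\<close> unfolding Pot_def enat by (subst ereal_divide_le_pos) (auto simp: mult.commute)
  qed
qed

end
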